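(* Let $\phi:(0,\infty)\to\mathbb{C}$ be mellin-proper, and suppose additionally that $\phi^\wedge$ is continuous on the closed strip $-\tfrac12\le\Re s\le1$, analytic in its interior, and does not vanish on the line $\Re s=-\tfrac12$. If $\mathbf{G}\phi(x)=O(x^{-1/2})$ as $x\to+\infty$, then the Riemann hypothesis holds and all nontrivial zeros of $\zeta$ are simple.
   Context: $\mu$ is the Möbius function and $g(x):=\sum_{n\le x}\mu(n)n^{-1}$ for $x>0$. For $a\in\mathbb{R}$, $N_a(f):=\int_0^\infty t^{-a-1}|f(t)|\,dt$. The (left-)Mellin transform of $f:(0,\infty)\to\mathbb{C}$ is $f^\wedge(s):=\int_0^\infty t^{-s-1}f(t)\,dt$ where the integral converges absolutely. $\phi$ is called proper if $N_\sigma(\phi)<\infty$ for all $\sigma\in(-\tfrac12,1]$, and mellin-proper if it is proper and $\phi^\wedge(s)\neq0$ for all $s$ with $-\tfrac12<\Re s<0$. For measurable $\phi$ and $x>0$, $\mathbf{G}\phi(x):=\int_0^\infty g(xt)\phi(t^{-1})t^{-1}\,dt$ whenever this integral converges absolutely. *)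

theory Defs
  imports
    "HOL-Complex_Analysis.Complex_Analysis"
    "HOL-Computational_Algebra.Squarefree"
    "HOL-Library.Landau_Symbols"
begin

section \<open>The Riemann zeta function\<close>

text \<open>
  The unique holomorphic continuation of the Dirichlet series to the plane punctured at 1;
  see \<open>ex1_zeta\<close> below for existence and uniqueness. The value at the pole is a dummy, fixed only to
  make the function unique.
\<close>

definition zeta :: "complex \<Rightarrow> complex" where
  "zeta = (THE f. f holomorphic_on (- {1}) \<and>
                  (\<forall>s. Re s > 1 \<longrightarrow> (\<lambda>n. of_nat (Suc n) powr (- s)) sums f s) \<and>
                  f 1 = 0)"

lemma gchoose_power_bound:
  fixes A :: real and K :: nat
  obtains C where "\<And>a x. norm a \<le> A \<Longrightarrow> 0 \<le> x \<Longrightarrow> x \<le> 1 \<Longrightarrow>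
    norm ((1 + of_real x) powr a - (\<Sum>i\<le>K. (a gchoose i) * of_real x ^ i) :: complex) \<le> C * x ^ Suc K"
proof
  fix a :: complex and x :: real
  assume a: "norm a \<le> A" and x: "0 \<le> x" "x \<le> 1"
  define S where "S = closed_segment 0 (1::complex)"
  define f where "f = (\<lambda>i (z::complex). (\<Prod>j=0..<i. a - of_nat j) * (1 + z) powr (a - of_nat i))"
  have A0: "0 \<le> A" using a norm_ge_zero order_trans by blast
  have S: "\<exists>t. z = of_real t \<and> 0 \<le> t \<and> t \<le> 1" if "z \<in> S" for z
    using that by (auto simp: S_def closed_segment_def scaleR_conv_of_real)
  have xS: "of_real x \<in> S"
    using x by (auto simp: S_def closed_segment_def scaleR_conv_of_real)
  have nb: "norm (a - of_nat j) \<le> A + real (Suc K)" if "j \<le> Suc K" for j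
  proof -
    have "norm (a - of_nat j) \<le> norm a + norm (of_nat j :: complex)" by (rule norm_triangle_ineq4)
    also have "\<dots> \<le> A + real (Suc K)" using a that by simp
    finally show ?thesis .
  qed
  have "norm (f 0 (of_real x) - (\<Sum>i\<le>K. f i 0 * (of_real x - 0) ^ i / fact i))
      \<le> ((A + real (Suc K)) ^ Suc K * 2 powr (A + real (Suc K))) * norm (of_real x - 0 :: complex) ^ Suc K / fact K"
  proof (rule complex_Taylor[of S])
    show "convex S" by (simp add: S_def)
    show "0 \<in> S" by (simp add: S_def)
    show "of_real x \<in> S" by fact
  next
    fix i z assume "z \<in> S" "i \<le> K"
    then obtain t where t: "z = of_real t" "0 \<le> t" using S by blast
    have "1 + z \<notin> \<real>\<^sub>\<le>\<^sub>0"
      using t by (auto simp: complex_nonpos_Reals_iff)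
    then show "(f i has_field_derivative f (Suc i) z) (at z within S)"
      unfolding f_def by (auto intro!: derivative_eq_intros simp: algebra_simps)
  next
    fix z assume "z \<in> S"
    then obtain t where t: "z = of_real t" "0 \<le> t" "t \<le> 1" using S by blast
    have "norm ((1 + z) powr (a - of_nat (Suc K))) = (1 + t) powr Re (a - of_nat (Suc K))"
      using t by (subst norm_powr_real_powr) auto
    also have "\<dots> \<le> (1 + t) powr (A + real (Suc K))"
      using t nb[of "Suc K"] complex_Re_le_cmod[of "a - of_nat (Suc K)"] by (intro powr_mono) auto
    also have "\<dots> \<le> 2 powr (A + real (Suc K))"
      using t A0 by (intro powr_mono2) auto
    finally have 1: "norm ((1 + z) powr (a - of_nat (Suc K))) \<le> 2 powr (A + real (Suc K))" .
    have "norm (\<Prod>j=0..<Suc K. a - of_nat j) \<le> (\<Prod>j=0..<Suc K. A + real (Suc K))"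
      unfolding prod_norm[symmetric] using nb by (intro prod_mono) auto
    then have "norm (\<Prod>j=0..<Suc K. a - of_nat j) \<le> (A + real (Suc K)) ^ Suc K"
      by simp
    with 1 show "norm (f (Suc K) z) \<le> (A + real (Suc K)) ^ Suc K * 2 powr (A + real (Suc K))"
      unfolding f_def norm_mult using A0 by (intro mult_mono) auto
  qed
  also have "(\<Sum>i\<le>K. f i 0 * (of_real x - 0) ^ i / fact i) = (\<Sum>i\<le>K. (a gchoose i) * of_real x ^ i)"
    by (intro sum.cong) (auto simp: f_def gbinomial_prod_rev)
  finally show "norm ((1 + of_real x) powr a - (\<Sum>i\<le>K. (a gchoose i) * of_real x ^ i) :: complex)
      \<le> ((A + real (Suc K)) ^ Suc K * 2 powr (A + real (Suc K)) / fact K) * x ^ Suc K"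
    using x by (simp add: f_def)
qed

lemma zeta_remainder_holomorphic:
  fixes K :: nat
  defines "f \<equiv> \<lambda>n (s::complex). of_nat (Suc (Suc n)) powr (1 - s) -
     (\<Sum>i\<le>K. ((1 - s) gchoose i) * of_nat (Suc n) powr (1 - s - of_nat i))"
  obtains R where "R holomorphic_on {s. Re s > 1 - real K}"
    "\<And>s. Re s > 1 - real K \<Longrightarrow> (\<lambda>n. f n s) sums R s"
proof -
  define S where "S = {s::complex. Re s > 1 - real K}"
  have hol: "f n holomorphic_on UNIV" for n
    unfolding f_def gbinomial_prod_rev by (intro holomorphic_intros) auto
  have "\<exists>R R'. \<forall>s\<in>S. (\<lambda>n. f n s) sums R s \<and> (\<lambda>n. deriv (f n) s) sums R' s \<and>
          (R has_field_derivative R' s) (at s)"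
  proof (rule series_and_derivative_comparison_local)
    show "open S" unfolding S_def by (rule open_halfspace_Re_gt)
    show "(f n has_field_derivative deriv (f n) s) (at s)" if "s \<in> S" for n s
      using hol[of n] by (intro holomorphic_derivI[of _ UNIV]) auto
    fix s assume "s \<in> S"
    define d where "d = (Re s - (1 - real K)) / 2"
    have d: "d > 0" using \<open>s \<in> S\<close> by (simp add: d_def S_def)
    obtain C where C: "\<And>a x. norm a \<le> 1 + norm s + d \<Longrightarrow> 0 \<le> x \<Longrightarrow> x \<le> 1 \<Longrightarrow>
      norm ((1 + of_real x) powr a - (\<Sum>i\<le>K. (a gchoose i) * of_real x ^ i) :: complex) \<le> C * x ^ Suc K"
      using gchoose_power_bound[of "1 + norm s + d" K] by blast
    have C0: "C \<ge> 0" using C[of 0 1] d norm_ge_zero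
      by (smt (verit) norm_ge_zero norm_zero power_one mult_cancel_left1)
    have bound: "norm (f n z) \<le> C * real (Suc n) powr (- 1 - d)" if "z \<in> ball s d" for n z
    proof -
      define m where "m = Suc n"
      define x where "x = 1 / real m"
      have m: "m > 0" by (simp add: m_def)
      have x: "0 \<le> x" "x \<le> 1" using m by (auto simp: x_def)
      have "norm (1 - z) \<le> 1 + norm z" by (metis norm_one norm_triangle_ineq4)
      also have "norm z \<le> norm s + d"
        using that norm_triangle_ineq2[of z s] by (auto simp: dist_norm norm_minus_commute)
      finally have nz: "norm (1 - z) \<le> 1 + norm s + d" by simp
      have "\<bar>Re (s - z)\<bar> < d"
        using that abs_Re_le_cmod[of "s - z"] by (simp add: dist_norm)
      moreover have "Re s = 1 - real K + 2 * d" by (simp add: d_def field_simps)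
      ultimately have rz: "Re z > 1 - real K + d" unfolding minus_complex.sel by linarith
      have e1: "of_nat (Suc m) powr (1 - z) = of_nat m powr (1 - z) * (1 + of_real x) powr (1 - z)"
      proof -
        have "(of_nat (Suc m) :: complex) = of_nat m * (1 + of_real x)"
          using m by (simp add: x_def field_simps)
        then show ?thesis using x by (simp add: powr_times_real)
      qed
      have e2: "of_nat m powr (1 - z - of_nat i) = of_nat m powr (1 - z) * (of_real x :: complex) ^ i" for i
      proof -
        have "(of_nat m :: complex) powr of_nat i = of_nat m ^ i"
          using m by (simp add: powr_nat)
        then show ?thesis by (subst powr_diff) (simp add: x_def power_one_over divide_inverse power_inverse)
      qed
      have "f n z = of_nat m powr (1 - z) *
          ((1 + of_real x) powr (1 - z) - (\<Sum>i\<le>K. ((1 - z) gchoose i) * of_real x ^ i))"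
        unfolding f_def m_def[symmetric] e1 e2
        by (simp add: algebra_simps sum_distrib_left)
      also have "norm \<dots> \<le> real m powr (1 - Re z) * (C * x ^ Suc K)"
        unfolding norm_mult using C[OF nz x] by (intro mult_mono) (auto simp: norm_powr_real_powr)
      also have "\<dots> = C * real m powr (- Re z - real K)"
      proof -
        have "x ^ Suc K = real m powr (- real (Suc K))"
        proof -
          have "real m powr real (Suc K) = real m ^ Suc K"
            using m by (intro powr_realpow) auto
          then show ?thesis
            unfolding powr_minus by (simp only:) (simp add: x_def power_one_over inverse_eq_divide del: power_Suc)
        qed
        then show ?thesis using m
          by (simp add: powr_add[symmetric] mult_ac del: power_Suc)
      qed
      also have "\<dots> \<le> C * real m powr (- 1 - d)"
        using rz m C0 by (intro mult_left_mono powr_mono) auto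
      finally show ?thesis by (simp add: m_def)
    qed
    have "summable (\<lambda>n. real n powr (- 1 - d))"
      using d by (simp add: summable_real_powr_iff)
    then have "summable (\<lambda>n. C * real (Suc n) powr (- 1 - d))"
      by (intro summable_mult) (simp only: summable_Suc_iff[of "\<lambda>n. real n powr (- 1 - d)"])
    then show "\<exists>d h. 0 < d \<and> summable h \<and>
        (\<forall>\<^sub>F n in sequentially. \<forall>y\<in>ball s d \<inter> S. norm (f n y) \<le> h n)"
      using d bound by (intro exI[of _ d] exI[of _ "\<lambda>n. C * real (Suc n) powr (- 1 - d)"]) auto
  qed
  then obtain R R' where R: "\<And>s. s \<in> S \<Longrightarrow> (\<lambda>n. f n s) sums R s"
      "\<And>s. s \<in> S \<Longrightarrow> (R has_field_derivative R' s) (at s)" by blast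
  have "R holomorphic_on S"
    unfolding holomorphic_on_def field_differentiable_def
    using R(2) has_field_derivative_at_within by blast
  with R(1) show ?thesis using that by (auto simp: S_def)
qed

lemma zeta_series_holomorphic:
  obtains D where "D holomorphic_on {s. Re s > 1}"
    "\<And>s. Re s > 1 \<Longrightarrow> (\<lambda>n. of_nat (Suc n) powr (- s)) sums D s"
proof -
  define S where "S = {s::complex. Re s > 1}"
  define f where "f = (\<lambda>n (s::complex). (of_nat (Suc n) :: complex) powr (- s))"
  have hol: "f n holomorphic_on UNIV" for n
    unfolding f_def by (intro holomorphic_intros)
  have "\<exists>R R'. \<forall>s\<in>S. (\<lambda>n. f n s) sums R s \<and> (\<lambda>n. deriv (f n) s) sums R' s \<and>
          (R has_field_derivative R' s) (at s)"
  proof (rule series_and_derivative_comparison_local)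
    show "open S" unfolding S_def by (rule open_halfspace_Re_gt)
    show "(f n has_field_derivative deriv (f n) s) (at s)" if "s \<in> S" for n s
      using hol[of n] by (intro holomorphic_derivI[of _ UNIV]) auto
    fix s assume "s \<in> S"
    define d where "d = (Re s - 1) / 2"
    have d: "d > 0" using \<open>s \<in> S\<close> by (simp add: d_def S_def)
    have bound: "norm (f n z) \<le> real (Suc n) powr (- 1 - d)" if "z \<in> ball s d" for n z
    proof -
      have "\<bar>Re (s - z)\<bar> < d"
        using that abs_Re_le_cmod[of "s - z"] by (simp add: dist_norm)
      moreover have "Re s = 1 + 2 * d" by (simp add: d_def field_simps)
      ultimately have rz: "Re z > 1 + d" unfolding minus_complex.sel by linarith
      have "norm (f n z) = real (Suc n) powr (- Re z)"
        unfolding f_def by (subst norm_powr_real_powr) auto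
      also have "\<dots> \<le> real (Suc n) powr (- 1 - d)"
        using rz by (intro powr_mono) auto
      finally show ?thesis .
    qed
    have "summable (\<lambda>n. real n powr (- 1 - d))"
      using d by (simp add: summable_real_powr_iff)
    then have "summable (\<lambda>n. real (Suc n) powr (- 1 - d))"
      by (simp only: summable_Suc_iff[of "\<lambda>n. real n powr (- 1 - d)"])
    then show "\<exists>d h. 0 < d \<and> summable h \<and>
        (\<forall>\<^sub>F n in sequentially. \<forall>y\<in>ball s d \<inter> S. norm (f n y) \<le> h n)"
      using d bound by (intro exI[of _ d] exI[of _ "\<lambda>n. real (Suc n) powr (- 1 - d)"]) auto
  qed
  then obtain R R' where R: "\<And>s. s \<in> S \<Longrightarrow> (\<lambda>n. f n s) sums R s"
      "\<And>s. s \<in> S \<Longrightarrow> (R has_field_derivative R' s) (at s)" by blast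
  have "R holomorphic_on S"
    unfolding holomorphic_on_def field_differentiable_def
    using R(2) has_field_derivative_at_within by blast
  with R(1) show ?thesis using that by (auto simp: S_def f_def)
qed

text \<open>
  Summing the binomial expansion of \<open>(n + 1) powr (1 - s)\<close> over \<open>n\<close> expresses
  \<open>(s - 1) \<zeta>(s)\<close> through the values \<open>(w - 1) \<zeta>(w)\<close> at \<open>w = s + 1, s + 2, \<dots>\<close> and a remainder, which
  moves the boundary of the half-plane to the left step by step.
\<close>

lemma zeta_continuation_halfplane:
  assumes D: "D holomorphic_on {s. Re s > 1}"
    "\<And>s. Re s > 1 \<Longrightarrow> (\<lambda>n. of_nat (Suc n) powr (- s)) sums D s"
  shows "\<exists>Z. Z holomorphic_on {s. Re s > 1 - real K} \<and> (\<forall>s. Re s > 1 \<longrightarrow> Z s = (s - 1) * D s)"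
proof (induction K)
  case 0
  show ?case using D(1) by (intro exI[of _ "\<lambda>s. (s - 1) * D s"]) (auto intro!: holomorphic_intros)
next
  case (Suc K)
  then obtain Z where Z: "Z holomorphic_on {s. Re s > 1 - real K}"
      "\<And>s. Re s > 1 \<Longrightarrow> Z s = (s - 1) * D s" by blast
  obtain R where R: "R holomorphic_on {s. Re s > 1 - real (Suc K)}"
    "\<And>s. Re s > 1 - real (Suc K) \<Longrightarrow> (\<lambda>n. of_nat (Suc (Suc n)) powr (1 - s) -
       (\<Sum>i\<le>Suc K. ((1 - s) gchoose i) * of_nat (Suc n) powr (1 - s - of_nat i))) sums R s"
    using zeta_remainder_holomorphic[of "Suc K"] by blast
  define W where "W = (\<lambda>s. 1 + R s -
    (\<Sum>i=1..K. ((1 - s) gchoose i) / of_nat (Suc i) * Z (s + of_nat i)))"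
  have "W holomorphic_on {s. Re s > 1 - real (Suc K)}"
  proof -
    have "(\<lambda>s. Z (s + of_nat i)) holomorphic_on {s. Re s > 1 - real (Suc K)}" if "i \<in> {1..K}" for i
      using that by (intro holomorphic_on_compose_gen[OF _ Z(1), unfolded o_def] holomorphic_intros) auto
    then show ?thesis
      unfolding W_def gbinomial_prod_rev by (intro holomorphic_intros R(1)) auto
  qed
  moreover have "W s = (s - 1) * D s" if s: "Re s > 1" for s
  proof -
    have lim: "(\<lambda>n. of_nat (Suc n) powr (1 - s) :: complex) \<longlonglongrightarrow> 0"
    proof (rule Lim_null_comparison)
      show "\<forall>\<^sub>F n in sequentially. norm (of_nat (Suc n) powr (1 - s)) \<le> real (Suc n) powr (1 - Re s)"
        by (auto simp: norm_powr_real_powr simp del: of_nat_Suc)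
      show "(\<lambda>n. real (Suc n) powr (1 - Re s)) \<longlonglongrightarrow> 0"
        using s by real_asymp
    qed
    have t: "(\<lambda>n. of_nat (Suc (Suc n)) powr (1 - s) - of_nat (Suc n) powr (1 - s)) sums
        (0 - (of_nat (Suc 0) powr (1 - s) :: complex))"
      by (rule telescope_sums[OF lim])
    have "(\<lambda>n. ((1 - s) gchoose Suc i) * of_nat (Suc n) powr (- (s + of_nat i))) sums
        (((1 - s) gchoose Suc i) * D (s + of_nat i))" for i
      using s by (intro sums_mult D(2)) auto
    then have "(\<lambda>n. \<Sum>i\<le>K. ((1 - s) gchoose Suc i) * of_nat (Suc n) powr (- (s + of_nat i))) sums
        (\<Sum>i\<le>K. ((1 - s) gchoose Suc i) * D (s + of_nat i))"
      by (intro sums_sum)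
    from sums_diff[OF t this]
    have "(\<lambda>n. of_nat (Suc (Suc n)) powr (1 - s) -
       (\<Sum>i\<le>Suc K. ((1 - s) gchoose i) * of_nat (Suc n) powr (1 - s - of_nat i))) sums
       (- 1 - (\<Sum>i\<le>K. ((1 - s) gchoose Suc i) * D (s + of_nat i)))"
      by (subst sum.atMost_Suc_shift) (simp add: algebra_simps del: of_nat_Suc sum.atMost_Suc, simp add: algebra_simps)
    then have "R s = - 1 - (\<Sum>i\<le>K. ((1 - s) gchoose Suc i) * D (s + of_nat i))"
      using R(2)[of s] s sums_unique2 by force
    also have "(\<Sum>i\<le>K. ((1 - s) gchoose Suc i) * D (s + of_nat i)) =
        (\<Sum>i\<le>K. - (((1 - s) gchoose i) / of_nat (Suc i) * Z (s + of_nat i)))"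
    proof (intro sum.cong refl)
      fix i
      have "((1 - s) gchoose Suc i) = ((1 - s) gchoose i) * (1 - s - of_nat i) / of_nat (Suc i)"
        using gbinomial_mult_1[of "1 - s" i] by (simp add: field_simps del: of_nat_Suc)
      moreover have "Z (s + of_nat i) = (s + of_nat i - 1) * D (s + of_nat i)"
        using s by (intro Z(2)) auto
      ultimately show "((1 - s) gchoose Suc i) * D (s + of_nat i) =
          - (((1 - s) gchoose i) / of_nat (Suc i) * Z (s + of_nat i))"
        by (simp only:) (simp add: divide_simps del: of_nat_Suc, simp add: algebra_simps)
    qed
    also have "\<dots> = - Z s - (\<Sum>i=1..K. ((1 - s) gchoose i) / of_nat (Suc i) * Z (s + of_nat i))"
      by (simp add: sum_negf atMost_atLeast0 sum.atLeast_Suc_atMost[of 0 K])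
    finally show ?thesis using Z(2)[OF s] by (simp add: W_def)
  qed
  ultimately show ?case by blast
qed

lemma ex1_zeta:
  "\<exists>!f. f holomorphic_on (- {1}) \<and>
        (\<forall>s. Re s > 1 \<longrightarrow> (\<lambda>n. of_nat (Suc n) powr (- s)) sums f s) \<and> f (1::complex) = 0"
proof (rule ex_ex1I)
  obtain D where D: "D holomorphic_on {s. Re s > 1}"
    "\<And>s. Re s > 1 \<Longrightarrow> (\<lambda>n. of_nat (Suc n) powr (- s)) sums D s"
    using zeta_series_holomorphic by blast
  obtain Z where Z: "\<And>K. Z K holomorphic_on {s. Re s > 1 - real K}"
    "\<And>K s. Re s > 1 \<Longrightarrow> Z K s = (s - 1) * D s"
    using zeta_continuation_halfplane[OF D] by metis
  have agree: "Z K s = Z L s" if "Re s > 1 - real K" "K \<le> L" for K L s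
  proof (rule analytic_continuation_open[of "{s. Re s > 1}" "{s. Re s > 1 - real K}" "Z K" "Z L"])
    show "{s. Re s > 1} \<noteq> {}" by (auto intro!: exI[of _ 2])
    show "connected {s. Re s > 1 - real K}" by (intro convex_connected convex_halfspace_Re_gt)
    show "Z L holomorphic_on {s. Re s > 1 - real K}"
      using that by (intro holomorphic_on_subset[OF Z(1)[of L]]) auto
  qed (use that Z in \<open>auto simp: open_halfspace_Re_gt\<close>)
  define k where "k = (\<lambda>s. Suc (nat \<lceil>1 - Re s\<rceil>))"
  define E where "E = (\<lambda>s. Z (k s) s)"
  have k: "Re s > 1 - real (k s)" for s
    unfolding k_def by linarith
  have E: "E s = Z K s" if "Re s > 1 - real K" for K s
  proof (cases "k s \<le> K")
    case True
    then show ?thesis unfolding E_def by (rule agree[OF k])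
  next
    case False
    then have "K \<le> k s" by simp
    then show ?thesis unfolding E_def by (rule agree[OF that, symmetric])
  qed
  have "E holomorphic_on UNIV"
  proof -
    have "E holomorphic_on (\<Union>K. {s. Re s > 1 - real K})"
    proof (rule holomorphic_on_UN_open)
      show "E holomorphic_on {s. Re s > 1 - real K}" for K
        using Z(1)[of K] by (rule holomorphic_transform) (use E in auto)
      show "open {s. Re s > 1 - real K}" for K by (rule open_halfspace_Re_gt)
    qed
    moreover have "(\<Union>K. {s. Re s > 1 - real K}) = UNIV" using k by auto
    ultimately show ?thesis by simp
  qed
  then have hol: "(\<lambda>s. E s / (s - 1)) holomorphic_on - {1}"
    by (intro holomorphic_intros) (auto intro: holomorphic_on_subset)
  define f where "f = (\<lambda>s. if s = 1 then 0 else E s / (s - 1))"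
  have "f holomorphic_on - {1}"
    using hol by (rule holomorphic_transform) (auto simp: f_def)
  moreover have "(\<lambda>n. of_nat (Suc n) powr (- s)) sums f s" if "Re s > 1" for s
  proof -
    have "s \<noteq> 1" using that by auto
    then have "f s = D s" using E[of 0 s] Z(2)[OF that] that by (simp add: f_def)
    then show ?thesis using D(2)[OF that] by simp
  qed
  ultimately show "\<exists>f. f holomorphic_on (- {1}) \<and>
        (\<forall>s. Re s > 1 \<longrightarrow> (\<lambda>n. of_nat (Suc n) powr (- s)) sums f s) \<and> f (1::complex) = 0"
    by (intro exI[of _ f]) (auto simp: f_def)
next
  fix f h :: "complex \<Rightarrow> complex"
  assume f: "f holomorphic_on (- {1}) \<and>
        (\<forall>s. Re s > 1 \<longrightarrow> (\<lambda>n. of_nat (Suc n) powr (- s)) sums f s) \<and> f 1 = 0"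
  assume h: "h holomorphic_on (- {1}) \<and>
        (\<forall>s. Re s > 1 \<longrightarrow> (\<lambda>n. of_nat (Suc n) powr (- s)) sums h s) \<and> h 1 = 0"
  have "f s = h s" if "s \<noteq> 1" for s
  proof (rule analytic_continuation_open[of "{s. Re s > 1}" "- {1}" f h])
    show "{s. Re s > 1} \<noteq> {}" by (auto intro!: exI[of _ 2])
    show "connected (- {1::complex})" by (intro connected_punctured_universe) auto
    show "f z = h z" if "z \<in> {s. Re s > 1}" for z
      using that f h sums_unique2 by blast
  qed (use that f h in \<open>auto simp: open_halfspace_Re_gt\<close>)
  with f h show "f = h" by (metis ext)
qed

lemma
  shows zeta_holomorphic: "zeta holomorphic_on (- {1})"
    and zeta_sums: "Re s > 1 \<Longrightarrow> (\<lambda>n. of_nat (Suc n) powr (- s)) sums zeta s"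
  using theI'[OF ex1_zeta] unfolding zeta_def by auto

text \<open>
  As usual, the nontrivial zeros are those in the critical strip; all other zeros are the
  negative even integers.
\<close>

definition nontrivial_zero :: "complex \<Rightarrow> bool" where
  "nontrivial_zero s \<longleftrightarrow> zeta s = 0 \<and> 0 < Re s \<and> Re s < 1"

definition riemann_hypothesis :: bool where
  "riemann_hypothesis \<longleftrightarrow> (\<forall>s. nontrivial_zero s \<longrightarrow> Re s = 1 / 2)"

section \<open>Moebius convolutions and the Mellin transform\<close>

definition moebius :: "nat \<Rightarrow> int" where
  "moebius n = (if squarefree n then (- 1) ^ card (prime_factors n) else 0)"

definition moebius_sum :: "real \<Rightarrow> real" where
  "moebius_sum x = (\<Sum>n | 1 \<le> n \<and> real n \<le> x. real_of_int (moebius n) / real n)"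

text \<open>
  Functions on \<open>(0,\<infinity>)\<close> are total functions on the reals of which only the values on \<open>{0<..}\<close>
  are used; measurability and integrals are with respect to Lebesgue measure.
\<close>

definition mellin_norm :: "real \<Rightarrow> (real \<Rightarrow> complex) \<Rightarrow> ennreal" where
  "mellin_norm a f = (\<integral>\<^sup>+ t\<in>{0<..}. ennreal (t powr (- a - 1) * norm (f t)) \<partial>lebesgue)"

text \<open>
  The Bochner integral is 0 where the integral does not converge absolutely, so \<open>mellin f s\<close> is
  meaningful only if \<open>f\<close> is measurable and \<open>mellin_norm (Re s) f < \<infinity>\<close>; similarly for \<open>moebius_conv\<close> below.
\<close>

definition mellin :: "(real \<Rightarrow> complex) \<Rightarrow> complex \<Rightarrow> complex" where
  "mellin f s = (LINT t:{0<..}|lebesgue. of_real t powr (- s - 1) * f t)"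

definition proper :: "(real \<Rightarrow> complex) \<Rightarrow> bool" where
  "proper \<phi> \<longleftrightarrow> \<phi> \<in> borel_measurable (lebesgue_on {0<..}) \<and>
                (\<forall>\<sigma>. - 1 / 2 < \<sigma> \<and> \<sigma> \<le> 1 \<longrightarrow> mellin_norm \<sigma> \<phi> < \<infinity>)"

definition mellin_proper :: "(real \<Rightarrow> complex) \<Rightarrow> bool" where
  "mellin_proper \<phi> \<longleftrightarrow> proper \<phi> \<and> (\<forall>s. - 1 / 2 < Re s \<and> Re s < 0 \<longrightarrow> mellin \<phi> s \<noteq> 0)"

text \<open>
  For proper \<open>\<phi>\<close> the integral converges absolutely for every \<open>x > 0\<close>, since \<open>moebius_sum\<close> is bounded and
  vanishes on \<open>(0,1)\<close>.
\<close>

definition moebius_conv :: "(real \<Rightarrow> complex) \<Rightarrow> real \<Rightarrow> complex" where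
  "moebius_conv \<phi> x = (LINT t:{0<..}|lebesgue. of_real (moebius_sum (x * t)) * \<phi> (inverse t) * of_real (inverse t))"

end

theory Submission
  imports Defs
begin

text \<open>
  Put \<open>H\<close> for the Mellin transform of \<open>\<^bold>G\<phi>\<close>. On \<open>0 < Re s < 1\<close> the convolution theorem and
  \<open>g\<^sup>\<and>(s) = 1 / (s \<zeta>(s + 1))\<close> give \<open>H(s) s \<zeta>(s + 1) = \<phi>\<^sup>\<and>(s)\<close>. The hypothesis on \<open>\<^bold>G\<phi>\<close> at infinity
  makes \<open>H\<close> holomorphic on \<open>- 1 / 2 < Re s < 1\<close>, so this identity continues to that strip, and a zero
  of \<open>\<zeta>\<close> in \<open>1 / 2 < Re s < 1\<close> would be a zero of \<open>\<phi>\<^sup>\<and>\<close> in \<open>- 1 / 2 < Re s < 0\<close>. The zeros left of the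
  critical line are excluded by the functional equation. The hypothesis also gives
  \<open>H(s) = O(1 / (Re s + 1 / 2))\<close>, and a multiple zero \<open>\<rho>\<close> would therefore force \<open>\<phi>\<^sup>\<and>(\<rho> - 1) = 0\<close>.
\<close>

section \<open>The Mellin transform\<close>

text \<open>The integral defining \<open>mellin \<phi>\<close> may diverge on the line Re s = - 1 /
  2, where the Bochner convention would return 0. The boundary values are therefore carried by a
  separate function \<open>F\<close>, which agrees with \<open>mellin \<phi>\<close> to the right of
  the line and is continuous up to it. For the zero \<rho> the line is approached horizontally, s =
  \<rho> - 1 + e with e > 0: at a multiple zero \<zeta>(s + 1) = o(e), while e H(s) stays bounded,
  so F(s) tends to 0. The right edge Re s = 1 of the strip comes from \<sigma> = 1 in properness,
  which together with |g(x)| \<le> x bounds \<open>moebius_conv \<phi>\<close> linearly near 0. The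
  point s = 0 has to be cut out of the continuation, because \<zeta>(s + 1) has its pole there and
  \<open>zeta 1\<close> is a dummy value.\<close>

definition mellin_convergent :: "(real \<Rightarrow> complex) \<Rightarrow> real \<Rightarrow> bool" where
  "mellin_convergent f \<sigma> \<longleftrightarrow> set_integrable lebesgue {0<..} (\<lambda>t. of_real (t powr (- \<sigma> - 1)) * f t)"

lemma of_real_powr_eq_exp: "t > 0 \<Longrightarrow> of_real t powr (c :: complex) = exp (c * of_real (ln t))"
  by (simp add: powr_def Ln_of_real)

text \<open>Measurability is transported from \<open>exp\<close> and the real \<open>ln\<close>; the
  cut-off at 0 is there because the identity between the two forms holds only for positive
  t.\<close>

lemma borel_measurable_of_real_powr:
  "(\<lambda>t. indicator {0<..} t *\<^sub>R (of_real t powr (c :: complex))) \<in> borel_measurable borel"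
proof -
  have "(\<lambda>t. indicator {0<..} t *\<^sub>R exp (c * of_real (ln t))) \<in> borel_measurable borel"
    by measurable
  also have "(\<lambda>t. indicator {0<..} t *\<^sub>R exp (c * of_real (ln t))) =
      (\<lambda>t. indicator {0<..} t *\<^sub>R (of_real t powr c))"
    by (auto simp: fun_eq_iff indicator_def of_real_powr_eq_exp)
  finally show ?thesis .
qed

lemma set_borel_measurable_powr_mult:
  assumes "set_borel_measurable lebesgue {0<..} f"
  shows "set_borel_measurable lebesgue {0<..} (\<lambda>t. of_real t powr (c :: complex) * f t)"
proof -
  have "(\<lambda>t. (indicator {0<..} t *\<^sub>R of_real t powr c) * (indicator {0<..} t *\<^sub>R f t))
      \<in> borel_measurable lebesgue"
    using assms unfolding set_borel_measurable_def
    by (intro borel_measurable_times)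
       (auto intro!: measurable_completion simp: borel_measurable_of_real_powr)
  also have "(\<lambda>t. (indicator {0<..} t *\<^sub>R of_real t powr c) * (indicator {0<..} t *\<^sub>R f t)) =
     (\<lambda>t. indicator {0<..} t *\<^sub>R (of_real t powr c * f t))"
    by (auto simp: fun_eq_iff indicator_def)
  finally show ?thesis unfolding set_borel_measurable_def .
qed

lemma mellin_convergent_measurable:
  assumes "mellin_convergent f \<sigma>"
  shows "set_borel_measurable lebesgue {0<..} f"
proof -
  have "set_borel_measurable lebesgue {0<..} (\<lambda>t. of_real (t powr (- \<sigma> - 1)) * f t)"
    using assms unfolding mellin_convergent_def set_integrable_def set_borel_measurable_def by auto
  \<comment> \<open>The exponent \<sigma> + 1 undoes the weight, which never vanishes on
    (0,\<infinity>).\<close>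
  from set_borel_measurable_powr_mult[OF this, of "of_real (\<sigma> + 1)"] show ?thesis
    unfolding set_borel_measurable_def
    by (rule back_subst[where P = "\<lambda>h. h \<in> borel_measurable lebesgue"])
       (auto simp: fun_eq_iff indicator_def powr_of_real powr_add[symmetric] simp flip: of_real_mult mult.assoc
             simp del: of_real_add of_real_diff)
qed

text \<open>The two weights have the same modulus, so only measurability of the other integrand has
  to be supplied.\<close>

lemma mellin_convergent_iff:
  "mellin_convergent f (Re s) \<longleftrightarrow> set_integrable lebesgue {0<..} (\<lambda>t. of_real t powr (- s - 1) * f t)"
proof
  assume *: "mellin_convergent f (Re s)"
  show "set_integrable lebesgue {0<..} (\<lambda>t. of_real t powr (- s - 1) * f t)"
    by (rule set_integrable_bound[OF *[unfolded mellin_convergent_def]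
          set_borel_measurable_powr_mult[OF mellin_convergent_measurable[OF *]]])
       (auto simp: norm_mult norm_powr_real_powr)
next
  assume *: "set_integrable lebesgue {0<..} (\<lambda>t. of_real t powr (- s - 1) * f t)"
  then have m: "set_borel_measurable lebesgue {0<..} (\<lambda>t. of_real t powr (- s - 1) * f t)"
    unfolding set_integrable_def set_borel_measurable_def by auto
  \<comment> \<open>A factor of modulus 1 turns the complex weight back into the real one.\<close>
  have powr: "of_real t powr (\<i> * of_real (Im s)) * of_real t powr (- s - 1) = complex_of_real (t powr (- Re s - 1))"
    if "t > 0" for t
  proof -
    have "\<i> * of_real (Im s) + (- s - 1) = complex_of_real (- Re s - 1)"
      by (simp add: complex_eq_iff)
    then show ?thesis using that
      by (metis less_imp_le powr_add powr_of_real)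
  qed
  have "set_borel_measurable lebesgue {0<..} (\<lambda>t. of_real (t powr (- Re s - 1)) * f t)"
    using set_borel_measurable_powr_mult[OF m, of "\<i> * of_real (Im s)"]
    unfolding set_borel_measurable_def
    by (rule back_subst[where P = "\<lambda>h. h \<in> borel_measurable lebesgue"])
       (auto simp: fun_eq_iff indicator_def powr simp flip: mult.assoc)
  with * show "mellin_convergent f (Re s)"
    unfolding mellin_convergent_def
    by (rule set_integrable_bound) (auto simp: norm_mult norm_powr_real_powr)
qed

lemma mellin_convergentI_norm:
  assumes m: "set_borel_measurable lebesgue {0<..} f" and fin: "mellin_norm \<sigma> f < \<infinity>"
  shows "mellin_convergent f \<sigma>"
proof -
  have "set_borel_measurable lebesgue {0<..} (\<lambda>t. of_real (t powr (- \<sigma> - 1)) * f t)"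
    using set_borel_measurable_powr_mult[OF m, of "of_real (- \<sigma> - 1)"]
    unfolding set_borel_measurable_def
    by (rule back_subst[where P = "\<lambda>h. h \<in> borel_measurable lebesgue"])
       (auto simp: fun_eq_iff indicator_def powr_of_real simp del: of_real_diff of_real_minus)
  moreover have "(\<integral>\<^sup>+ t. ennreal (norm (indicator {0<..} t *\<^sub>R (of_real (t powr (- \<sigma> - 1)) * f t))) \<partial>lebesgue)
      = mellin_norm \<sigma> f"
    unfolding mellin_norm_def
    by (intro nn_integral_cong) (auto simp: indicator_def norm_mult)
  ultimately show ?thesis
    using fin unfolding mellin_convergent_def set_integrable_def set_borel_measurable_def
    by (simp add: integrable_iff_bounded)
qed

lemma mellin_convergent_cong:
  assumes "\<And>t. t > 0 \<Longrightarrow> f t = g t"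
  shows "mellin_convergent f \<sigma> \<longleftrightarrow> mellin_convergent g \<sigma>"
  unfolding mellin_convergent_def by (intro set_integrable_cong) (use assms in auto)

lemma mellin_cong:
  assumes "\<And>t. t > 0 \<Longrightarrow> f t = g t"
  shows "mellin f s = mellin g s"
  unfolding mellin_def by (intro set_lebesgue_integral_cong) (use assms in auto)

section \<open>Holomorphy and bounds in a strip\<close>

text \<open>Controls the exponential series of t^(-(s - s0)) by two powers, so that integrability on
  the lines Re s0 - d and Re s0 + d covers every s within distance d of s0.\<close>

lemma exp_abs_ln_le:
  fixes t :: real
  assumes "t > 0" "0 \<le> x" "x \<le> d"
  shows "exp (x * \<bar>ln t\<bar>) \<le> t powr d + t powr (- d)"
proof -
  have "exp (x * \<bar>ln t\<bar>) \<le> exp (d * \<bar>ln t\<bar>)"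
    using assms by (auto intro: mult_right_mono)
  also have "\<dots> \<le> t powr d + t powr (- d)"
    using assms by (cases "ln t \<ge> 0") (auto simp: powr_def abs_if)
  finally show ?thesis .
qed

lemma open_Re_strip: "open {s. a < Re s \<and> Re s < b}"
  using open_Int[OF open_halfspace_Re_gt[of a] open_halfspace_Re_lt[of b]]
  by (simp add: Collect_conj_eq)

lemma convex_Re_strip: "convex {s. a < Re s \<and> Re s < b}"
  using convex_Int[OF convex_halfspace_Re_gt[of a] convex_halfspace_Re_lt[of b]]
  by (simp add: Collect_conj_eq)

text \<open>The integrand is expanded in powers of s - s0 and integrated term by term, so the
  transform is locally a power series. One majorant serves the whole disc: the sum of the absolute
  integrands on two vertical lines of the strip.\<close>

lemma mellin_holomorphic:
  assumes conv: "\<And>\<sigma>. a < \<sigma> \<Longrightarrow> \<sigma> < b \<Longrightarrow> mellin_convergent f \<sigma>"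
  shows "mellin f holomorphic_on {s. a < Re s \<and> Re s < b}"
proof -
  have "\<exists>r>0. mellin f holomorphic_on ball s0 r" if s0: "a < Re s0" "Re s0 < b" for s0
  proof -
    \<comment> \<open>Half the distance to the boundary keeps the lines Re s0 - r and Re s0 + r
      inside the strip.\<close>
    define r where "r = min (Re s0 - a) (b - Re s0) / 2"
    have r: "r > 0" "a < Re s0 - r" "Re s0 + r < b"
      using s0 by (auto simp: r_def min_def field_simps)
    define w where "w = (\<lambda>t. indicator {0<..} t *\<^sub>R (of_real t powr (- s0 - 1) * f t))"
    define G where "G = (\<lambda>t. indicator {0<..} t *\<^sub>R (of_real (t powr (- (Re s0 - r) - 1)) * f t))"
    define G' where "G' = (\<lambda>t. indicator {0<..} t *\<^sub>R (of_real (t powr (- (Re s0 + r) - 1)) * f t))"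
    have GG: "integrable lebesgue G" "integrable lebesgue G'"
      using r conv[of "Re s0 - r"] conv[of "Re s0 + r"]
      unfolding mellin_convergent_def set_integrable_def G_def G'_def by simp_all
    have w_int: "integrable lebesgue w"
      using conv[of "Re s0"] s0 unfolding mellin_convergent_iff set_integrable_def w_def by simp
    define H where "H = (\<lambda>t. norm (G t) + norm (G' t))"
    have H: "integrable lebesgue H" unfolding H_def using GG by auto
    have exp_w: "exp (x * \<bar>ln t\<bar>) * norm (w t) \<le> H t" if "0 \<le> x" "x \<le> r" for x t
    proof (cases "t > 0")
      case True
      have "exp (x * \<bar>ln t\<bar>) * norm (w t) \<le> (t powr r + t powr (- r)) * (t powr (- Re s0 - 1) * norm (f t))"
        using True exp_abs_ln_le[OF True that]
        by (auto simp: w_def norm_mult norm_powr_real_powr intro!: mult_right_mono)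
      also have "\<dots> = H t" using True
        by (simp add: H_def G_def G'_def norm_mult distrib_right powr_add[symmetric] algebra_simps
            flip: mult.assoc)
      finally show ?thesis .
    qed (auto simp: w_def H_def)
    \<comment> \<open>Taylor coefficients at s0 of the integrand as a function of s.\<close>
    define e where "e = (\<lambda>n t. (- of_real (ln t)) ^ n / fact n * w t)"
    have sums_e: "(\<lambda>n. norm (e n t) * x ^ n) sums (exp (x * \<bar>ln t\<bar>) * norm (w t))" for t x
    proof -
      have "(\<lambda>n. (x * \<bar>ln t\<bar>) ^ n /\<^sub>R fact n * norm (w t)) sums (exp (x * \<bar>ln t\<bar>) * norm (w t))"
        by (intro sums_mult2 exp_converges)
      then show ?thesis
        by (simp add: e_def norm_mult norm_divide norm_power power_mult_distrib field_simps)
    qed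
    have part: "(\<Sum>i\<in>I. norm (e i t) * x ^ i) \<le> H t" if "0 \<le> x" "x \<le> r" "finite I" for I x t
    proof -
      have "(\<Sum>i\<in>I. norm (e i t) * x ^ i) \<le> exp (x * \<bar>ln t\<bar>) * norm (w t)"
        unfolding sums_unique[OF sums_e[of t x]] using that
        by (intro sum_le_suminf sums_summable[OF sums_e]) auto
      then show ?thesis using exp_w[OF that(1,2), of t] by linarith
    qed
    have meas: "e n \<in> borel_measurable lebesgue" for n
    proof -
      have "w \<in> borel_measurable lebesgue" using w_int by auto
      then show ?thesis unfolding e_def by (intro borel_measurable_times) (auto simp: measurable_completion)
    qed
    have e_int: "integrable lebesgue (\<lambda>t. e n t * c ^ n)" if "norm c < r" for n c
      by (rule Bochner_Integration.integrable_bound[OF H])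
         (use meas part[of "norm c" "{n}"] that in \<open>auto simp: norm_mult norm_power H_def intro!: AE_I2\<close>)
    have e0: "integrable lebesgue (e n)" for n
    proof -
      have "integrable lebesgue (\<lambda>t. e n t * of_real (r/2) ^ n)"
        by (rule e_int) (use r in auto)
      then have "integrable lebesgue (\<lambda>t. e n t * of_real (r/2) ^ n * inverse (of_real (r/2) ^ n))"
        by (rule integrable_mult_left)
      then show ?thesis using r by (simp add: mult.assoc right_inverse)
    qed
    have "(\<lambda>n. integral\<^sup>L lebesgue (e n) * (s - s0) ^ n) sums mellin f s" if s: "s \<in> ball s0 r" for s
    proof -
      have ns: "norm (s - s0) < r" using s by (simp add: dist_norm norm_minus_commute)
      have "(\<lambda>n. LINT t|lebesgue. e n t * (s - s0) ^ n) sums (LINT t|lebesgue. (\<Sum>n. e n t * (s - s0) ^ n))"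
      proof (rule sums_integral)
        show "integrable lebesgue (\<lambda>t. e n t * (s - s0) ^ n)" for n using e_int[OF ns] .
        show "AE t in lebesgue. summable (\<lambda>n. norm (e n t * (s - s0) ^ n))"
          using sums_summable[OF sums_e] by (simp add: norm_mult norm_power)
        show "summable (\<lambda>n. LINT t|lebesgue. norm (e n t * (s - s0) ^ n))"
        proof (rule summableI_nonneg_bounded)
          fix n
          have "(\<Sum>i<n. LINT t|lebesgue. norm (e i t * (s - s0) ^ i))
              = (LINT t|lebesgue. (\<Sum>i<n. norm (e i t * (s - s0) ^ i)))"
            using e_int[OF ns] by (subst Bochner_Integration.integral_sum) auto
          also have "\<dots> \<le> (LINT t|lebesgue. H t)"
            by (intro integral_mono Bochner_Integration.integrable_sum integrable_norm e_int[OF ns] H)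
               (use part[of "norm (s - s0)"] ns in \<open>auto simp: norm_mult norm_power\<close>)
          finally show "(\<Sum>i<n. LINT t|lebesgue. norm (e i t * (s - s0) ^ i)) \<le> (LINT t|lebesgue. H t)" .
        qed auto
      qed
      moreover have "(\<Sum>n. e n t * (s - s0) ^ n) = indicator {0<..} t *\<^sub>R (of_real t powr (- s - 1) * f t)" for t
      proof (rule sums_unique[symmetric])
        have "(\<lambda>n. ((- of_real (ln t)) * (s - s0)) ^ n /\<^sub>R fact n * w t) sums
            (exp ((- of_real (ln t)) * (s - s0)) * w t)"
          by (intro sums_mult2 exp_converges)
        moreover have "exp ((- of_real (ln t)) * (s - s0)) * w t =
            indicator {0<..} t *\<^sub>R (of_real t powr (- s - 1) * f t)"
        proof -
          have "(- of_real (ln t)) * (s - s0) + (- s0 - 1) * of_real (ln t) = (- s - 1) * of_real (ln t)"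
            by (simp add: algebra_simps)
          then show ?thesis
            by (auto simp: w_def indicator_def of_real_powr_eq_exp exp_add[symmetric] simp flip: mult.assoc)
        qed
        ultimately show "(\<lambda>n. e n t * (s - s0) ^ n) sums (indicator {0<..} t *\<^sub>R (of_real t powr (- s - 1) * f t))"
          by (simp only: e_def power_mult_distrib scaleR_conv_of_real of_real_inverse of_real_fact divide_inverse mult_ac)
      qed
      ultimately show ?thesis
        by (simp add: mellin_def set_lebesgue_integral_def)
    qed
    then have "mellin f holomorphic_on ball s0 r" by (rule power_series_holomorphic)
    with r show ?thesis by blast
  qed
  then have "mellin f analytic_on {s. a < Re s \<and> Re s < b}"
    unfolding analytic_on_def by auto
  then show ?thesis using analytic_imp_holomorphic by blast
qed

text \<open>The function is compared with A t^a below X and with B t^b above X. The explicit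
  constants matter: the factor 1 / (Re s - b) becomes the growth rate of H at the left edge of its
  strip.\<close>

lemma
  fixes A B a b X :: real
  assumes m: "set_borel_measurable lebesgue {0<..} f" and X: "X > 0" and AB: "A \<ge> 0" "B \<ge> 0"
    and A: "\<And>t. 0 < t \<Longrightarrow> t < X \<Longrightarrow> norm (f t) \<le> A * t powr a"
    and B: "\<And>t. X \<le> t \<Longrightarrow> norm (f t) \<le> B * t powr b"
    and s: "b < Re s" "Re s < a"
  shows mellin_convergent_if_bounds: "mellin_convergent f (Re s)"
    and norm_mellin_le_if_bounds:
      "norm (mellin f s) \<le> A * (X powr (a - Re s) / (a - Re s)) + B * (X powr (b - Re s) / (Re s - b))"
proof -
  define V where "V = A * (X powr (a - Re s) / (a - Re s)) + B * (X powr (b - Re s) / (Re s - b))"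
  define D where "D = (\<lambda>t. if t < X then A * t powr (a - Re s - 1) else B * t powr (b - Re s - 1))"
  have "((\<lambda>t. A * t powr (a - Re s - 1)) has_integral (A * (X powr (a - Re s) / (a - Re s)))) {0..X}"
    using has_integral_powr_from_0[of "a - Re s - 1" X] s X
    by (intro has_integral_mult_right) simp
  then have 1: "(D has_integral (A * (X powr (a - Re s) / (a - Re s)))) {0..X}"
    by (rule has_integral_spike_finite[of "{X}", rotated 2]) (auto simp: D_def)
  have "((\<lambda>t. B * t powr (b - Re s - 1)) has_integral (B * (X powr (b - Re s) / (Re s - b)))) {X..}"
    using has_integral_powr_to_inf[of "b - Re s - 1" X] s X
    by (intro has_integral_mult_right) (simp add: minus_divide_right)
  then have 2: "(D has_integral (B * (X powr (b - Re s) / (Re s - b)))) {X..}"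
    by (rule has_integral_spike_finite[of "{}", rotated 2]) (auto simp: D_def)
  have "(D has_integral V) ({0..X} \<union> {X..})"
    unfolding V_def by (rule has_integral_Un[OF 1 2]) (use X in \<open>auto simp: atLeastAtMost_singleton_iff
      intro: negligible_subset[of "{X}"]\<close>)
  moreover have "{0..X} \<union> {X..} = {0..}" using X by auto
  ultimately have "(D has_integral V) {0..}" by simp
  then have D: "(D has_integral V) {0<..}"
    by (rule has_integral_spike_set_eq[THEN iffD1, rotated 2]) (auto intro: negligible_subset[of "{0}"])
  then have Dint: "set_integrable lebesgue {0<..} D"
    by (intro nonnegative_absolutely_integrable_1) (use AB in \<open>auto simp: D_def\<close>)
  have bound: "norm (of_real t powr (- s - 1) * f t) \<le> D t" if "t > 0" for t
  proof -
    have "norm (of_real t powr (- s - 1) * f t) = t powr (- Re s - 1) * norm (f t)"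
      using that by (simp add: norm_mult norm_powr_real_powr)
    also have "\<dots> \<le> t powr (- Re s - 1) * (if t < X then A * t powr a else B * t powr b)"
      using A[OF that] B[of t] by (intro mult_left_mono) auto
    also have "\<dots> = D t" by (auto simp: D_def powr_add[symmetric] algebra_simps)
    finally show ?thesis .
  qed
  have int: "set_integrable lebesgue {0<..} (\<lambda>t. of_real t powr (- s - 1) * f t)"
    by (rule set_integrable_bound[OF Dint set_borel_measurable_powr_mult[OF m]])
       (use bound in \<open>auto intro: order_trans[OF _ abs_ge_self]\<close>)
  then show "mellin_convergent f (Re s)" by (simp add: mellin_convergent_iff)
  have "norm (mellin f s) \<le> (LINT t:{0<..}|lebesgue. norm (of_real t powr (- s - 1) * f t))"
    unfolding mellin_def by (rule set_integral_norm_bound[OF int])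
  also have "\<dots> \<le> (LINT t:{0<..}|lebesgue. D t)"
    by (rule set_integral_mono[OF set_integrable_norm[OF int] Dint]) (use bound in auto)
  also have "\<dots> = V"
    using D Dint by (metis integral_unique set_lebesgue_integral_eq_integral(2))
  finally show "norm (mellin f s) \<le> V" .
qed

section \<open>Scaling, series, inversion and convolution\<close>

lemma
  assumes c: "c > 0"
  shows mellin_convergent_scale: "mellin_convergent (\<lambda>t. f (c * t)) \<sigma> \<longleftrightarrow> mellin_convergent f \<sigma>"
    and mellin_scale: "mellin (\<lambda>t. f (c * t)) s = of_real c powr s * mellin f s"
proof -
  define h where "h = (\<lambda>s t. indicator {0<..} t *\<^sub>R (of_real t powr (- s - 1) * f t))"
  define k where "k = (\<lambda>s t. indicator {0<..} t *\<^sub>R (of_real t powr (- s - 1) * f (c * t)))"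
  have hk: "h s (0 + c * t) = of_real c powr (- s - 1) * k s t" for s t
    using c by (auto simp: h_def k_def indicator_def zero_less_mult_iff powr_times_real)
  have "integrable lebesgue (k s) \<longleftrightarrow> integrable lebesgue (h s)" for s
    using lebesgue_integrable_real_affine_iff[of c "h s" 0] c unfolding hk
    using integrable_mult_right[of "inverse (of_real c powr (- s - 1))" lebesgue "\<lambda>t. of_real c powr (- s - 1) * k s t"]
      integrable_mult_right[of "of_real c powr (- s - 1)" lebesgue "k s"]
    by (auto simp: mult.assoc[symmetric])
  from this[of "of_real \<sigma>"]
  show "mellin_convergent (\<lambda>t. f (c * t)) \<sigma> \<longleftrightarrow> mellin_convergent f \<sigma>"
    using mellin_convergent_iff[of _ "of_real \<sigma>"] unfolding set_integrable_def h_def k_def by simp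
  have "mellin f s = of_real c * (of_real c powr (- s - 1) * mellin (\<lambda>t. f (c * t)) s)"
    using lebesgue_integral_real_affine[of c "h s" 0] c unfolding hk
    by (simp add: mellin_def set_lebesgue_integral_def h_def k_def scaleR_conv_of_real)
  also have "\<dots> = of_real c powr (- s) * mellin (\<lambda>t. f (c * t)) s"
    using c by (simp add: powr_diff)
  finally show "mellin (\<lambda>t. f (c * t)) s = of_real c powr s * mellin f s"
    using c by (simp add: powr_minus)
qed

text \<open>With the L1 norm written as a transform at a real point, the scaling and linearity rules
  also evaluate the norms that termwise integration and Fubini ask for. The outer norm on the right
  only passes from a complex value to a real one.\<close>

lemma integral_norm_mellin:
  "(LINT t|lebesgue. norm (indicator {0<..} t *\<^sub>R (of_real t powr (- s - 1) * f t))) =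
     norm (mellin (\<lambda>t. of_real (norm (f t))) (of_real (Re s)))"
proof -
  have "complex_of_real (norm (indicator {0<..} t *\<^sub>R (of_real t powr (- s - 1) * f t))) =
      indicator {0<..} t *\<^sub>R (of_real t powr (- of_real (Re s) - 1) * of_real (norm (f t)))" for t
    using powr_of_real[of t "- Re s - 1"] by (auto simp: indicator_def norm_mult norm_powr_real_powr)
  then have "(LINT t|lebesgue. complex_of_real (norm (indicator {0<..} t *\<^sub>R (of_real t powr (- s - 1) * f t)))) =
      mellin (\<lambda>t. of_real (norm (f t))) (of_real (Re s))"
    by (simp only: mellin_def set_lebesgue_integral_def)
  then have "norm (complex_of_real (LINT t|lebesgue. norm (indicator {0<..} t *\<^sub>R (of_real t powr (- s - 1) * f t)))) =
      norm (mellin (\<lambda>t. of_real (norm (f t))) (of_real (Re s)))"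
    by (simp only: integral_complex_of_real)
  then show ?thesis by simp
qed

text \<open>Absolute termwise integration, with the L1 condition in the form of
  \<open>integral_norm_mellin\<close>. It is applied to the step functions composing
  \<open>moebius_sum\<close> and to a Fourier series.\<close>

lemma
  assumes conv: "\<And>n. mellin_convergent (f n) (Re s)"
    and sum: "\<And>t. t > 0 \<Longrightarrow> summable (\<lambda>n. norm (f n t))"
    and norms: "summable (\<lambda>n. norm (mellin (\<lambda>t. of_real (norm (f n t))) (of_real (Re s))))"
  shows mellin_convergent_suminf: "mellin_convergent (\<lambda>t. \<Sum>n. f n t) (Re s)"
    and mellin_sums: "(\<lambda>n. mellin (f n) s) sums mellin (\<lambda>t. \<Sum>n. f n t) s"
proof -
  define h where "h = (\<lambda>n t. indicator {0<..} t *\<^sub>R (of_real t powr (- s - 1) * f n t))"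
  have int: "integrable lebesgue (h n)" for n
    using conv[of n] by (simp add: h_def mellin_convergent_iff set_integrable_def)
  have h_sum: "summable (\<lambda>n. norm (h n t))" for t
    using summable_mult[OF sum, of t "norm (of_real t powr (- s - 1) :: complex)"]
    by (cases "t > 0") (auto simp: h_def norm_mult)
  then have AE: "AE t in lebesgue. summable (\<lambda>n. norm (h n t))" by simp
  have norms': "summable (\<lambda>n. LINT t|lebesgue. norm (h n t))"
    unfolding h_def integral_norm_mellin by (rule norms)
  have suminf_h: "(\<Sum>n. h n t) = indicator {0<..} t *\<^sub>R (of_real t powr (- s - 1) * (\<Sum>n. f n t))" for t
  proof (cases "t > 0")
    case True
    then show ?thesis
      using suminf_mult[OF summable_norm_cancel[OF sum[OF True]], of "of_real t powr (- s - 1)"]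
      by (simp add: h_def)
  qed (simp add: h_def)
  show "mellin_convergent (\<lambda>t. \<Sum>n. f n t) (Re s)"
    using integrable_suminf[OF int AE norms'] unfolding suminf_h mellin_convergent_iff set_integrable_def .
  show "(\<lambda>n. mellin (f n) s) sums mellin (\<lambda>t. \<Sum>n. f n t) s"
    using sums_integral[OF int AE norms'] unfolding suminf_h
    by (simp add: h_def mellin_def set_lebesgue_integral_def)
qed

lemma mellin_cmult: "mellin (\<lambda>t. c * f t) s = c * mellin f s"
  unfolding mellin_def set_lebesgue_integral_def
  by (subst integral_mult_right_zero[symmetric]) (auto intro!: Bochner_Integration.integral_cong)

lemma mellin_convergent_cmult:
  "mellin_convergent f \<sigma> \<Longrightarrow> mellin_convergent (\<lambda>t. c * f t) \<sigma>"
  using set_integrable_mult_right[of c lebesgue "{0<..}" "\<lambda>t. of_real (t powr (- \<sigma> - 1)) * f t"]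
  by (simp add: mellin_convergent_def mult_ac)

text \<open>Substitution of 1 / t. The factor 1 / t in \<psi> comes from the kernel of
  \<open>moebius_conv\<close> and accounts for the shift from - s to - s - 1.\<close>

lemma
  fixes \<phi> :: "real \<Rightarrow> complex"
  defines "\<psi> \<equiv> \<lambda>t. \<phi> (inverse t) * of_real (inverse t)"
  assumes conv: "mellin_convergent \<phi> (Re s)"
  shows mellin_convergent_inversion: "mellin_convergent \<psi> (- Re s - 1)"
    and mellin_inversion: "mellin \<psi> (- s - 1) = mellin \<phi> s"
proof -
  define f where "f = (\<lambda>t. of_real t powr (- s - 1) * \<phi> t)"
  have img: "inverse ` {0::real<..} = {0<..}"
  proof (intro equalityI subsetI)
    fix t :: real assume "t \<in> {0<..}"
    then show "t \<in> inverse ` {0<..}" by (intro image_eqI[where x = "inverse t"]) auto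
  qed auto
  have int: "set_integrable lebesgue (inverse ` {0<..}) f"
    using conv unfolding img mellin_convergent_iff f_def .
  \<comment> \<open>The Jacobian t^(-2) and (1 / t)^(-s - 1) = t^(s + 1) give t^(s - 1); \<psi>
    takes one factor 1 / t of this, which leaves t^s.\<close>
  have eq: "\<bar>- inverse (t ^ 2)\<bar> *\<^sub>R f (inverse t) = of_real t powr (- (- s - 1) - 1) * \<psi> t" if "t > 0" for t
  proof -
    have "of_real t powr (- s - 1) * of_real t powr (s + 1) = (1::complex)"
      using that by (simp add: powr_add[symmetric])
    moreover have "of_real (inverse t) powr (- s - 1) = inverse (of_real t powr (- s - 1) :: complex)"
      using that by (simp only: of_real_powr_eq_exp positive_imp_inverse_positive ln_inverse of_real_minus
          mult_minus_right exp_minus)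
    ultimately have "of_real (inverse t) powr (- s - 1) = (of_real t powr (s + 1) :: complex)"
      by (simp add: inverse_unique)
    then show ?thesis using that
      by (simp add: f_def \<psi>_def scaleR_conv_of_real powr_add power2_eq_square)
  qed
  have "set_integrable lebesgue {0<..} (\<lambda>t. \<bar>- inverse (t ^ 2)\<bar> *\<^sub>R f (inverse t)) \<and>
     integral {0<..} (\<lambda>t. \<bar>- inverse (t ^ 2)\<bar> *\<^sub>R f (inverse t)) = integral (inverse ` {0<..}) f"
    by (subst has_absolute_integral_change_of_variables_real)
       (use int in \<open>auto simp: inj_on_def power2_eq_square intro!: derivative_eq_intros\<close>)
  moreover have "set_integrable lebesgue {0<..} (\<lambda>t. \<bar>- inverse (t ^ 2)\<bar> *\<^sub>R f (inverse t)) \<longleftrightarrow>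
      set_integrable lebesgue {0<..} (\<lambda>t. of_real t powr (- (- s - 1) - 1) * \<psi> t)"
    by (rule set_integrable_cong) (use eq in auto)
  moreover have "integral {0<..} (\<lambda>t. \<bar>- inverse (t ^ 2)\<bar> *\<^sub>R f (inverse t)) =
      integral {0<..} (\<lambda>t. of_real t powr (- (- s - 1) - 1) * \<psi> t)"
    by (rule Henstock_Kurzweil_Integration.integral_cong) (use eq in auto)
  ultimately have *: "set_integrable lebesgue {0<..} (\<lambda>t. of_real t powr (- (- s - 1) - 1) * \<psi> t)"
    and **: "integral {0<..} (\<lambda>t. of_real t powr (- (- s - 1) - 1) * \<psi> t) = integral {0<..} f"
    unfolding img by simp_all
  show "mellin_convergent \<psi> (- Re s - 1)"
    using * mellin_convergent_iff[of \<psi> "- s - 1"] by simp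
  show "mellin \<psi> (- s - 1) = mellin \<phi> s"
    unfolding mellin_def using * ** int[unfolded img]
    by (simp add: set_lebesgue_integral_eq_integral(2) f_def)
qed

text \<open>Completion does not change the measure of Borel sets, so a countable Borel cover by sets
  of finite measure still works. This makes Fubini available on a product of completed
  measures.\<close>

lemma sigma_finite_lebesgue: "sigma_finite_measure (lebesgue :: 'a :: euclidean_space measure)"
proof
  obtain A :: "'a set set" where A: "countable A" "A \<subseteq> sets lborel" "\<Union>A = space lborel"
      "\<forall>a\<in>A. emeasure lborel a \<noteq> \<infinity>"
    using lborel.sigma_finite_countable by blast
  have "emeasure lebesgue a = emeasure lborel a" if "a \<in> A" for a
    using that A(2) by (subst emeasure_completion) (auto simp: main_part_sets)
  then show "\<exists>A::'a set set. countable A \<and> A \<subseteq> sets lebesgue \<and> \<Union> A = space lebesgue \<and>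
      (\<forall>a\<in>A. emeasure lebesgue a \<noteq> \<infinity>)"
    using A by (intro exI[of _ A]) auto
qed

text \<open>Fubini with x integrated first: for fixed t, scaling turns the inner integral into t^s
  times the transform of g, and what remains is the transform of \<psi> at - s - 1. Borel
  measurability of g ensures that g (x t) is jointly measurable; a merely Lebesgue measurable outer
  function need not compose.\<close>

lemma
  fixes g \<phi> :: "real \<Rightarrow> complex"
  defines "G \<equiv> \<lambda>x. (LINT t:{0<..}|lebesgue. g (x * t) * \<phi> (inverse t) * of_real (inverse t))"
  assumes gm: "g \<in> borel_measurable borel"
    and g: "mellin_convergent g (Re s)" and \<phi>: "mellin_convergent \<phi> (Re s)"
  shows mellin_convergent_convolution: "mellin_convergent G (Re s)"
    and mellin_convolution: "mellin G s = mellin g s * mellin \<phi> s"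
proof -
  define \<psi> where "\<psi> = (\<lambda>t. \<phi> (inverse t) * of_real (inverse t))"
  have \<psi>: "mellin_convergent \<psi> (- Re s - 1)" "mellin \<psi> (- s - 1) = mellin \<phi> s"
    unfolding \<psi>_def using \<phi> by (rule mellin_convergent_inversion mellin_inversion)+
  interpret L: pair_sigma_finite "lebesgue :: real measure" "lebesgue :: real measure"
    by (simp add: pair_sigma_finite_def sigma_finite_lebesgue)
  define w where "w = (\<lambda>x. indicator {0<..} x *\<^sub>R (of_real x powr (- s - 1) :: complex))"
  define v where "v = (\<lambda>t. indicator {0<..} t *\<^sub>R \<psi> t)"
  define f where "f = (\<lambda>t x. w x * (g (x * t) * v t))"
  have wm: "w \<in> borel_measurable lebesgue"
    unfolding w_def by (intro measurable_completion) (simp add: borel_measurable_of_real_powr)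
  have vm: "v \<in> borel_measurable lebesgue"
    using mellin_convergent_measurable[OF \<psi>(1)] by (simp add: v_def set_borel_measurable_def)
  have id: "(\<lambda>x. x) \<in> borel_measurable (lebesgue :: real measure)"
    by (auto intro: measurable_completion)
  have "(\<lambda>p. snd p * fst p) \<in> borel_measurable (lebesgue \<Otimes>\<^sub>M lebesgue :: (real \<times> real) measure)"
    using measurable_compose[OF measurable_fst id] measurable_compose[OF measurable_snd id]
    by (rule borel_measurable_times[rotated])
  from measurable_compose[OF this gm] measurable_compose[OF measurable_fst vm] measurable_compose[OF measurable_snd wm]
  have fm: "case_prod f \<in> borel_measurable (lebesgue \<Otimes>\<^sub>M lebesgue)"
    unfolding f_def case_prod_beta by (intro borel_measurable_times)
  have inner: "integrable lebesgue (\<lambda>x. f t x)"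
    "(LINT x|lebesgue. f t x) = indicator {0<..} t *\<^sub>R (of_real t powr s * \<psi> t) * mellin g s"
    "(LINT x|lebesgue. norm (f t x)) =
       norm (indicator {0<..} t *\<^sub>R (of_real t powr s * \<psi> t)) * norm (mellin (\<lambda>x. of_real (norm (g x))) (of_real (Re s)))"
    for t
  proof -
    have v0: "v t = 0" if "\<not> t > 0" using that by (simp add: v_def)
    have f_eq: "f t x = indicator {0<..} x *\<^sub>R (of_real x powr (- s - 1) * g (t * x)) * v t" for x
      by (simp add: f_def w_def mult_ac)
    show "integrable lebesgue (\<lambda>x. f t x)"
    proof (cases "t > 0")
      case True
      then have "mellin_convergent (\<lambda>x. g (t * x)) (Re s)"
        using g by (simp add: mellin_convergent_scale)
      then show ?thesis
        unfolding f_eq mellin_convergent_iff set_integrable_def by (intro integrable_mult_left)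
    qed (simp add: f_eq v0)
    show "(LINT x|lebesgue. f t x) = indicator {0<..} t *\<^sub>R (of_real t powr s * \<psi> t) * mellin g s"
    proof (cases "t > 0")
      case True
      have "(LINT x|lebesgue. f t x) = mellin (\<lambda>x. g (t * x)) s * v t"
        unfolding f_eq mellin_def set_lebesgue_integral_def by (rule integral_mult_left_zero)
      with True show ?thesis by (simp add: mellin_scale v_def)
    qed (simp add: f_eq v0)
    show "(LINT x|lebesgue. norm (f t x)) =
       norm (indicator {0<..} t *\<^sub>R (of_real t powr s * \<psi> t)) * norm (mellin (\<lambda>x. of_real (norm (g x))) (of_real (Re s)))"
    proof (cases "t > 0")
      case True
      have "(LINT x|lebesgue. norm (f t x)) = norm (mellin (\<lambda>x. of_real (norm (g (t * x)))) (of_real (Re s))) * norm (v t)"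
        unfolding f_eq norm_mult[of _ "v t"] integral_mult_left_zero integral_norm_mellin ..
      with True show ?thesis
        using mellin_scale[OF True, of "\<lambda>x. of_real (norm (g x))"]
        by (simp add: norm_mult norm_powr_real_powr v_def mult_ac)
    qed (simp add: f_eq v0)
  qed
  have \<psi>int: "integrable lebesgue (\<lambda>t. indicator {0<..} t *\<^sub>R (of_real t powr s * \<psi> t))"
    using \<psi>(1) mellin_convergent_iff[of \<psi> "- s - 1"] by (simp add: set_integrable_def)
  have fint: "integrable (lebesgue \<Otimes>\<^sub>M lebesgue) (case_prod f)"
  proof (rule L.Fubini_integrable[OF fm])
    show "integrable lebesgue (\<lambda>t. LINT x|lebesgue. norm (case (t, x) of (t, x) \<Rightarrow> f t x))"
      unfolding prod.case inner(3) by (intro integrable_mult_left integrable_norm \<psi>int)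
    show "AE t in lebesgue. integrable lebesgue (\<lambda>x. case (t, x) of (t, x) \<Rightarrow> f t x)"
      unfolding prod.case using inner(1) by simp
  qed
  have G: "(LINT t|lebesgue. f t x) = indicator {0<..} x *\<^sub>R (of_real x powr (- s - 1) * G x)" for x
  proof -
    have "(LINT t|lebesgue. f t x) = w x * (LINT t|lebesgue. g (x * t) * v t)"
      unfolding f_def by (rule integral_mult_right_zero)
    also have "(LINT t|lebesgue. g (x * t) * v t) = G x"
      unfolding G_def set_lebesgue_integral_def v_def \<psi>_def by (simp add: mult.assoc)
    finally show ?thesis by (auto simp: w_def)
  qed
  show "mellin_convergent G (Re s)"
    using L.integrable_snd[OF fint] unfolding G by (simp add: mellin_convergent_iff set_integrable_def)
  have "mellin G s = (LINT x|lebesgue. LINT t|lebesgue. f t x)"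
    unfolding G mellin_def set_lebesgue_integral_def ..
  also have "\<dots> = (LINT t|lebesgue. indicator {0<..} t *\<^sub>R (of_real t powr s * \<psi> t) * mellin g s)"
    unfolding L.Fubini_integral[OF fint] inner ..
  also have "\<dots> = mellin g s * mellin \<phi> s"
    unfolding \<psi>(2)[symmetric] mellin_def[of \<psi>] set_lebesgue_integral_def
    by (subst integral_mult_left_zero) (simp add: mult.commute)
  finally show "mellin G s = mellin g s * mellin \<phi> s" .
qed

section \<open>Explicit transforms and shifts\<close>

text \<open>\<open>moebius_sum\<close> is a combination of these step functions, so their transforms
  produce its Dirichlet series.\<close>

lemma
  fixes n :: real
  assumes n: "n > 0" and s: "Re s > 0"
  shows mellin_convergent_indicator_atLeast: "mellin_convergent (indicator {n..}) (Re s)"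
    and mellin_indicator_atLeast: "mellin (indicator {n..}) s = of_real n powr (- s) / s"
proof -
  have m: "set_borel_measurable lebesgue {0<..} (indicator {n..} :: real \<Rightarrow> complex)"
    unfolding set_borel_measurable_def by (intro measurable_completion) simp
  show c: "mellin_convergent (indicator {n..}) (Re s)"
    \<comment> \<open>The function vanishes below n, hence A = 0, and the exponent a only has to
      exceed Re s.\<close>
    by (rule mellin_convergent_if_bounds[OF m n, of 0 1 "Re s + 1" 0])
       (use s n in \<open>auto simp: indicator_def\<close>)
  have s0: "s \<noteq> 0" using s by auto
  define F where "F = (\<lambda>t. - (of_real t powr (- s) / s))"
  have int: "set_integrable lebesgue {n..} (\<lambda>t. of_real t powr (- s - 1))"
  proof -
    have "set_integrable lebesgue {n..} (\<lambda>t. of_real t powr (- s - 1) * indicator {n..} t)"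
      using c n unfolding mellin_convergent_iff by (rule_tac set_integrable_subset) auto
    also have "?this \<longleftrightarrow> ?thesis" by (rule set_integrable_cong) auto
    finally show ?thesis .
  qed
  have FTC: "(LINT t:{n..y}|lebesgue. of_real t powr (- s - 1)) = F y - F n" if "y \<ge> n" for y
  proof -
    have "((\<lambda>t. of_real t powr (- s - 1)) has_integral (F y - F n)) {n..y}"
    proof (rule fundamental_theorem_of_calculus[OF that])
      fix t assume "t \<in> {n..y}"
      then have t: "t > 0" using n by auto
      have "((\<lambda>z. - (z powr (- s) / s)) has_field_derivative of_real t powr (- s - 1)) (at (of_real t))"
        using t s0 by (auto intro!: derivative_eq_intros simp: complex_nonpos_Reals_iff)
      then have "(F has_vector_derivative (1 * of_real t powr (- s - 1))) (at t)"
        unfolding F_def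
        by (rule field_vector_diff_chain_at[of of_real 1 t "\<lambda>z. - (z powr (- s) / s)", unfolded o_def, rotated])
           (auto intro: has_vector_derivative_of_real[OF DERIV_ident, of "at t", simplified])
      then show "(F has_vector_derivative of_real t powr (- s - 1)) (at t within {n..y})"
        by (simp add: has_vector_derivative_at_within)
    qed
    moreover have "set_integrable lebesgue {n..y} (\<lambda>t. of_real t powr (- s - 1))"
      using int by (rule set_integrable_subset) auto
    ultimately show ?thesis
      by (metis integral_unique set_lebesgue_integral_eq_integral(2))
  qed
  have "((\<lambda>y. LINT t:{n..y}|lebesgue. of_real t powr (- s - 1)) \<longlongrightarrow>
      (LINT t:{n..}|lebesgue. of_real t powr (- s - 1))) at_top"
    using int by (intro tendsto_set_lebesgue_integral_at_top) auto
  moreover have "eventually (\<lambda>y. (LINT t:{n..y}|lebesgue. of_real t powr (- s - 1)) = F y - F n) at_top"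
    using eventually_ge_at_top[of n] by eventually_elim (rule FTC)
  ultimately have "((\<lambda>y. F y - F n) \<longlongrightarrow> (LINT t:{n..}|lebesgue. of_real t powr (- s - 1))) at_top"
    by (rule Lim_transform_eventually)
  moreover have "((\<lambda>y. F y - F n) \<longlongrightarrow> 0 - F n) at_top"
  proof (intro tendsto_diff tendsto_const)
    have "((\<lambda>y. y powr (- Re s) / norm s) \<longlongrightarrow> 0) at_top"
      using s by (intro tendsto_divide_zero tendsto_neg_powr filterlim_ident) auto
    moreover have "eventually (\<lambda>y. norm (F y) \<le> y powr (- Re s) / norm s) at_top"
      using eventually_gt_at_top[of 0]
      by eventually_elim (simp add: F_def norm_divide norm_powr_real_powr)
    ultimately show "(F \<longlongrightarrow> 0) at_top" by (rule Lim_null_comparison[rotated])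
  qed
  ultimately have "(LINT t:{n..}|lebesgue. of_real t powr (- s - 1)) = 0 - F n"
    by (rule tendsto_unique[OF trivial_limit_at_top_linorder])
  then have "(LINT t:{n..}|lebesgue. of_real t powr (- s - 1)) = of_real n powr (- s) / s"
    by (simp add: F_def)
  moreover have "mellin (indicator {n..}) s = (LINT t:{n..}|lebesgue. of_real t powr (- s - 1))"
    unfolding mellin_def set_lebesgue_integral_def
    by (intro Bochner_Integration.integral_cong) (use n in \<open>auto simp: indicator_def\<close>)
  ultimately show "mellin (indicator {n..}) s = of_real n powr (- s) / s" by simp
qed

lemma
  assumes "mellin_convergent f (Re s)" "mellin_convergent g (Re s)"
  shows mellin_convergent_add: "mellin_convergent (\<lambda>t. f t + g t) (Re s)"
    and mellin_add: "mellin (\<lambda>t. f t + g t) s = mellin f s + mellin g s"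
    and mellin_diff: "mellin (\<lambda>t. f t - g t) s = mellin f s - mellin g s"
  using assms unfolding mellin_convergent_iff mellin_def
  by (simp_all add: distrib_left right_diff_distrib)

lemma mellin_power_mult: "mellin (\<lambda>t. of_real t ^ k * f t) s = mellin f (s - of_nat k)"
  and mellin_convergent_power_mult:
    "mellin_convergent (\<lambda>t. of_real t ^ k * f t) (Re s) \<longleftrightarrow> mellin_convergent f (Re s - real k)"
proof -
  have eq: "of_real t powr (- s - 1) * (of_real t ^ k * f t) = of_real t powr (- (s - of_nat k) - 1) * f t"
    if "t > 0" for t
    using that powr_add[of "of_real t :: complex" "- s - 1" "of_nat k"]
    by (simp add: powr_nat algebra_simps)
  show "mellin (\<lambda>t. of_real t ^ k * f t) s = mellin f (s - of_nat k)"
    unfolding mellin_def by (intro set_lebesgue_integral_cong) (use eq in auto)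
  have "mellin_convergent (\<lambda>t. of_real t ^ k * f t) (Re s) \<longleftrightarrow> mellin_convergent f (Re (s - of_nat k))"
    unfolding mellin_convergent_iff by (intro set_integrable_cong) (use eq in auto)
  then show "mellin_convergent (\<lambda>t. of_real t ^ k * f t) (Re s) \<longleftrightarrow> mellin_convergent f (Re s - real k)"
    by simp
qed

text \<open>The map from t to 1 / t carries [1,\<infinity>) to (0,1]; multiplying by t then removes
  the factor 1 / t that \<open>mellin_inversion\<close> attaches.\<close>

lemma
  assumes s: "Re s < 0"
  shows mellin_convergent_indicator_unit: "mellin_convergent (indicator {0<..1}) (Re s)"
    and mellin_indicator_unit: "mellin (indicator {0<..1}) s = - 1 / s"
proof -
  define \<psi> where "\<psi> = (\<lambda>t::real. indicator {1..} (inverse t) * of_real (inverse t) :: complex)"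
  have s': "Re (- s) > 0" using s by simp
  have c: "mellin_convergent \<psi> (- Re (- s) - 1)"
    unfolding \<psi>_def
    by (rule mellin_convergent_inversion) (use mellin_convergent_indicator_atLeast[OF _ s', of 1] in simp)
  have m: "mellin \<psi> (- (- s) - 1) = 1 / (- s)"
    unfolding \<psi>_def
    by (subst mellin_inversion)
       (use mellin_convergent_indicator_atLeast[OF _ s', of 1] mellin_indicator_atLeast[OF _ s', of 1] in simp_all)
  have eq: "of_real t ^ 1 * \<psi> t = indicator {0<..1} t" if "t > 0" for t
    using that by (auto simp: \<psi>_def indicator_def one_le_inverse_iff)
  have "mellin_convergent (\<lambda>t. of_real t ^ 1 * \<psi> t) (Re s)"
    using c by (subst mellin_convergent_power_mult) simp
  then show "mellin_convergent (indicator {0<..1}) (Re s)"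
    by (simp only: mellin_convergent_cong[OF eq])
  have "mellin (indicator {0<..1}) s = mellin (\<lambda>t. of_real t ^ 1 * \<psi> t) s"
    by (rule mellin_cong[OF eq[symmetric]])
  then show "mellin (indicator {0<..1}) s = - 1 / s"
    using m by (subst (asm) mellin_power_mult) simp
qed

section \<open>The Moebius function\<close>

lemma moebius_prime_mult:
  assumes "prime p" "\<not> p dvd d"
  shows "moebius (p * d) = - moebius d"
proof (cases "squarefree d")
  case True
  have "d \<noteq> 0" using assms by (auto intro: Nat.gr0I)
  have cop: "coprime p d" using assms by (simp add: prime_imp_coprime)
  have "squarefree (p * d)"
    using cop assms True by (simp add: squarefree_mult_coprime squarefree_prime)
  moreover have "prime_factors (p * d) = insert p (prime_factors d)"
    using assms \<open>d \<noteq> 0\<close> by (simp add: prime_factors_product prime_prime_factors)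
  moreover have "p \<notin> prime_factors d" using assms by auto
  ultimately show ?thesis using True by (simp add: moebius_def)
next
  case False
  moreover have "\<not> squarefree (p * d)" using False squarefree_multD(2) by blast
  ultimately show ?thesis by (simp add: moebius_def)
qed

text \<open>For a prime p dividing n, the squarefree divisors split into those prime to p and their
  p-fold multiples, and the two halves cancel.\<close>

lemma sum_moebius_divisors:
  assumes "n > 0"
  shows "(\<Sum>d | d dvd n. moebius d) = (if n = 1 then 1 else 0)"
proof (cases "n = 1")
  case True
  then show ?thesis by (simp add: moebius_def)
next
  case False
  then obtain p where p: "prime p" "p dvd n" using prime_factor_nat by blast
  define S where "S = {d. d dvd n \<and> squarefree d \<and> \<not> p dvd d}"
  have fin: "finite {d. d dvd n}" using assms by simp
  have "finite S" by (rule finite_subset[OF _ fin]) (auto simp: S_def)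
  have p0: "p \<noteq> 0" using p by auto
  have eq: "{d. d dvd n \<and> squarefree d} = S \<union> (*) p ` S"
  proof (intro equalityI subsetI)
    fix d assume d: "d \<in> {d. d dvd n \<and> squarefree d}"
    show "d \<in> S \<union> (*) p ` S"
    proof (cases "p dvd d")
      case True
      then obtain e where e: "d = p * e" by blast
      have "\<not> p dvd e"
      proof
        assume "p dvd e"
        then have "p\<^sup>2 dvd d" by (auto simp: e power2_eq_square)
        then have "p dvd 1" using d unfolding squarefree_def by blast
        then show False using p by simp
      qed
      then show ?thesis
        using d e squarefree_multD(2)[of p e] by (auto simp: S_def intro: dvd_mult_right)
    qed (use d in \<open>auto simp: S_def\<close>)
  next
    fix d assume d: "d \<in> S \<union> (*) p ` S"
    show "d \<in> {d. d dvd n \<and> squarefree d}"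
    proof (cases "d \<in> S")
      case False
      then obtain e where e: "e \<in> S" "d = p * e" using d by auto
      have cop: "coprime p e" using p e by (simp add: S_def prime_imp_coprime)
      then have "p * e dvd n" using e p by (auto simp: S_def intro: divides_mult)
      moreover have "squarefree (p * e)"
        using cop e p by (simp add: squarefree_mult_coprime squarefree_prime S_def)
      ultimately show ?thesis using e by simp
    qed (auto simp: S_def)
  qed
  have "(\<Sum>d | d dvd n. moebius d) = (\<Sum>d | d dvd n \<and> squarefree d. moebius d)"
    by (rule sum.mono_neutral_right[OF fin]) (auto simp: moebius_def)
  also have "\<dots> = (\<Sum>d\<in>S. moebius d) + (\<Sum>d\<in>(*) p ` S. moebius d)"
    unfolding eq by (rule sum.union_disjoint) (use \<open>finite S\<close> in \<open>auto simp: S_def\<close>)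
  also have "(\<Sum>d\<in>(*) p ` S. moebius d) = (\<Sum>d\<in>S. moebius (p * d))"
    by (subst sum.reindex) (use p0 in \<open>auto simp: inj_on_def\<close>)
  also have "\<dots> = (\<Sum>d\<in>S. - moebius d)"
    by (intro sum.cong refl moebius_prime_mult p) (auto simp: S_def)
  finally show ?thesis using False by (simp add: sum_negf)
qed

lemma abs_moebius_le: "\<bar>moebius n\<bar> \<le> 1"
  by (simp add: moebius_def power_abs)

lemma norm_moebius_le: "norm (of_int (moebius n) :: complex) \<le> 1"
  using abs_moebius_le[of n] by (simp add: norm_of_int flip: of_int_abs)

lemma summable_norm_powr:
  assumes "Re w > 1"
  shows "summable (\<lambda>n. norm (of_nat n powr (- w) :: complex))"
proof -
  have "norm (of_nat n powr (- w) :: complex) = real n powr (- Re w)" for n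
    by (cases "n = 0") (simp_all add: norm_powr_real_powr)
  then show ?thesis using assms by (simp add: summable_real_powr_iff)
qed

text \<open>As \<open>0 powr z = 0\<close>, the index 0 contributes nothing, and later sums can run
  over all naturals without a shift.\<close>

lemma zeta_sums_nat:
  assumes "Re w > 1"
  shows "(\<lambda>n. of_nat n powr (- w)) sums zeta w"
  using zeta_sums[OF assms] by (subst (asm) sums_Suc_iff) simp

text \<open>Dirichlet multiplication: the absolutely convergent double series over (d, k) is
  regrouped by n = d k, and the coefficient of n^(-w) is a divisor sum of \<mu>.\<close>

lemma
  assumes w: "Re w > 1"
  shows summable_norm_moebius_powr: "summable (\<lambda>n. norm (of_int (moebius n) * of_nat n powr (- w) :: complex))"
    and suminf_moebius_powr_mult_zeta: "(\<Sum>n. of_int (moebius n) * of_nat n powr (- w)) * zeta w = 1"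
proof -
  define a where "a = (\<lambda>n. of_int (moebius n) * of_nat n powr (- w) :: complex)"
  define b where "b = (\<lambda>n. of_nat n powr (- w) :: complex)"
  have b: "summable (\<lambda>n. norm (b n))" unfolding b_def using summable_norm_powr[OF w] .
  have a: "summable (\<lambda>n. norm (a n))"
    by (rule summable_comparison_test'[OF b, of 0])
       (use mult_right_mono[OF norm_moebius_le] in \<open>auto simp: a_def b_def norm_mult\<close>)
  then show "summable (\<lambda>n. norm (of_int (moebius n) * of_nat n powr (- w) :: complex))"
    by (simp add: a_def)
  have aS: "(a has_sum suminf a) UNIV" and bS: "(b has_sum suminf b) UNIV"
    using a b summable_norm_cancel by (auto intro!: norm_summable_imp_has_sum summable_sums)
  have absa: "(\<lambda>n. norm (a n)) summable_on UNIV" and absb: "(\<lambda>n. norm (b n)) summable_on UNIV"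
    using a b by (auto intro!: norm_summable_imp_summable_on)
  define f where "f = (\<lambda>(d, k). a d * b k)"
  have fabs: "(\<lambda>p. norm (f p)) summable_on UNIV \<times> UNIV"
    unfolding Infinite_Sum.abs_summable_on_Sigma_iff
    using absa absb by (auto simp: f_def norm_mult infsum_cmult_right' abs_mult infsum_nonneg
        intro!: summable_on_cmult_right summable_on_cmult_left)
  then have fsum: "f summable_on UNIV \<times> UNIV" by (rule abs_summable_summable)
  have "infsum f (UNIV \<times> UNIV) = infsum (\<lambda>d. infsum (\<lambda>k. a d * b k) UNIV) UNIV"
    using infsum_Sigma_banach[OF fsum] by (simp add: f_def)
  also have "\<dots> = suminf a * suminf b"
    using aS bS by (simp add: infsum_cmult_right' infsum_cmult_left' infsumI)
  finally have 1: "infsum f (UNIV \<times> UNIV) = suminf a * suminf b" .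
  \<comment> \<open>Pairs (n, d) with d dividing n, matched with the positive pairs (d, k) through k
    = n div d.\<close>
  define T where "T = (SIGMA n:{0<..}. {d::nat. d dvd n})"
  have bij: "bij_betw (\<lambda>(n, d). (d, n div d)) T ({0<..} \<times> {0<..})"
    by (rule bij_betwI[where g = "\<lambda>(d, k). (d * k, d)"]) (auto simp: T_def dvd_div_eq_0_iff)
  \<comment> \<open>Pairs containing 0 drop out because \<open>0 powr z = 0\<close>.\<close>
  have "infsum f (UNIV \<times> UNIV) = infsum f ({0<..} \<times> {0<..})"
    by (rule infsum_cong_neutral) (auto simp: f_def a_def b_def)
  also have "\<dots> = infsum (\<lambda>x. f ((\<lambda>(n, d). (d, n div d)) x)) T"
    by (rule infsum_reindex_bij_betw[OF bij, symmetric])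
  also have "\<dots> = infsum (\<lambda>n. infsum (\<lambda>d. f (d, n div d)) {d. d dvd n}) {0<..}"
  proof -
    have "f summable_on {0<..} \<times> {0<..}" by (rule summable_on_subset_banach[OF fsum]) auto
    then have "(\<lambda>x. f ((\<lambda>(n, d). (d, n div d)) x)) summable_on T"
      by (subst summable_on_reindex_bij_betw[OF bij])
    from infsum_Sigma_banach[OF this[unfolded T_def]] show ?thesis unfolding T_def by simp
  qed
  also have "\<dots> = infsum (\<lambda>n. if n = 1 then 1 else 0) {0::nat<..}"
  proof (intro infsum_cong)
    fix n :: nat assume "n \<in> {0<..}"
    then have n: "n > 0" by simp
    have fin: "finite {d. d dvd n}" using n by simp
    have "infsum (\<lambda>d. f (d, n div d)) {d. d dvd n} = (\<Sum>d | d dvd n. f (d, n div d))"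
      using fin by simp
    also have "\<dots> = (\<Sum>d | d dvd n. of_int (moebius d) * of_nat n powr (- w))"
    proof (rule sum.cong[OF refl])
      fix d assume "d \<in> {d. d dvd n}"
      then obtain k where k: "n = d * k" by auto
      then have "d > 0" "n div d = k" using n by auto
      moreover have "of_nat (d * k) powr (- w) = (of_nat d powr (- w) * of_nat k powr (- w) :: complex)"
        using powr_times_real[of "of_nat d" "of_nat k" "- w"] by simp
      ultimately show "f (d, n div d) = of_int (moebius d) * of_nat n powr (- w)"
        by (simp add: f_def a_def b_def k)
    qed
    also have "\<dots> = of_int (\<Sum>d | d dvd n. moebius d) * of_nat n powr (- w)"
      by (simp add: sum_distrib_right)
    also have "\<dots> = (if n = 1 then 1 else 0)"
      using sum_moebius_divisors[OF n] by simp
    finally show "infsum (\<lambda>d. f (d, n div d)) {d. d dvd n} = (if n = 1 then 1 else 0)" .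
  qed
  also have "\<dots> = infsum (\<lambda>n. 1 :: complex) {1::nat}"
    by (rule infsum_cong_neutral) auto
  finally have "suminf a * suminf b = 1" using 1 by simp
  moreover have "suminf b = zeta w"
    unfolding b_def using zeta_sums_nat[OF w] by (rule sums_unique[symmetric])
  ultimately show "(\<Sum>n. of_int (moebius n) * of_nat n powr (- w)) * zeta w = 1"
    by (simp add: a_def)
qed

section \<open>The partial sums of \<mu>(n) / n\<close>

text \<open>At each x only finitely many indicators are nonzero, and the index 0 vanishes through
  division by 0. A range of summation independent of x allows termwise transforms and shows Borel
  measurability.\<close>

lemma moebius_sum_eq_suminf:
  "complex_of_real (moebius_sum x) = (\<Sum>n. of_int (moebius n) / of_nat n * indicator {real n..} x)"
proof -
  have fin: "finite {n. 1 \<le> n \<and> real n \<le> x}"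
    by (rule finite_subset[of _ "{..nat \<lfloor>x\<rfloor>}"]) (auto simp: le_nat_floor)
  have "(\<Sum>n. of_int (moebius n) / of_nat n * indicator {real n..} x :: complex) =
      (\<Sum>n | 1 \<le> n \<and> real n \<le> x. of_int (moebius n) / of_nat n * indicator {real n..} x)"
    by (rule suminf_finite[OF fin]) (auto simp: indicator_def not_le)
  also have "\<dots> = complex_of_real (moebius_sum x)"
    unfolding moebius_sum_def of_real_sum by (intro sum.cong) auto
  finally show ?thesis by simp
qed

lemma summable_norm_moebius_indicator:
  "summable (\<lambda>n. norm (of_int (moebius n) / of_nat n * indicator {real n..} x :: complex))"
  by (rule summable_finite[of "{..nat \<lfloor>x\<rfloor>}"])
     (use le_nat_floor not_le in \<open>fastforce simp: indicator_def\<close>)+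

text \<open>There are at most \<lfloor>x\<rfloor> terms, each of size at most 1. A linear bound is
  what pairs with \<sigma> = 1 in \<open>proper\<close>.\<close>

lemma abs_moebius_sum_le: "x \<ge> 0 \<Longrightarrow> \<bar>moebius_sum x\<bar> \<le> x"
proof -
  assume x: "x \<ge> 0"
  define S where "S = {n. 1 \<le> n \<and> real n \<le> x}"
  have S: "S \<subseteq> {1..nat \<lfloor>x\<rfloor>}" by (auto simp: S_def le_nat_floor)
  have "\<bar>moebius_sum x\<bar> \<le> (\<Sum>n\<in>S. \<bar>real_of_int (moebius n) / real n\<bar>)"
    unfolding moebius_sum_def S_def by (rule sum_abs)
  also have "\<dots> \<le> (\<Sum>n\<in>S. 1)"
  proof (rule sum_mono)
    fix n assume "n \<in> S"
    then have "n \<ge> 1" by (simp add: S_def)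
    moreover have "\<bar>real_of_int (moebius n)\<bar> \<le> 1"
      using abs_moebius_le[of n] by linarith
    ultimately show "\<bar>real_of_int (moebius n) / real n\<bar> \<le> 1"
      by (simp add: divide_le_eq)
  qed
  also have "\<dots> \<le> real (nat \<lfloor>x\<rfloor>)"
    using card_mono[OF _ S] by simp
  also have "\<dots> \<le> x" using x by simp
  finally show ?thesis .
qed

lemma borel_measurable_moebius_sum: "moebius_sum \<in> borel_measurable borel"
proof -
  have "(\<lambda>x. \<Sum>n. of_int (moebius n) / of_nat n * indicator {real n..} x :: complex) \<in> borel_measurable borel"
    by measurable
  then have "(\<lambda>x. Re (complex_of_real (moebius_sum x))) \<in> borel_measurable borel"
    unfolding moebius_sum_eq_suminf[symmetric] by measurable
  then show ?thesis by simp
qed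

text \<open>Termwise, the jump at n contributes \<mu>(n) n^(-s - 1) / s, and the Dirichlet series of
  \<mu> inverts \<zeta>(s + 1). The product form is the one that can be continued across zeros of
  \<zeta>.\<close>

lemma
  assumes s: "Re s > 0"
  shows mellin_convergent_moebius_sum: "mellin_convergent (\<lambda>x. of_real (moebius_sum x)) (Re s)"
    and mellin_moebius_sum: "mellin (\<lambda>x. of_real (moebius_sum x)) s * (s * zeta (s + 1)) = 1"
proof -
  define f where "f = (\<lambda>n t. of_int (moebius n) / of_nat n * indicator {real n..} t :: complex)"
  \<comment> \<open>At n = 0 both sides are 0: by division by 0 on the left, by
    \<open>0 powr z = 0\<close> on the right.\<close>
  have mellin_ind: "of_int (moebius n) / of_nat n * mellin (indicator {real n..}) z =
      of_int (moebius n) * of_nat n powr (- (z + 1)) / z" if "Re z > 0" for n z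
    by (cases "n = 0") (use that in \<open>simp_all add: mellin_indicator_atLeast powr_diff\<close>)
  have conv: "mellin_convergent (f n) (Re s)" for n
  proof (cases "n = 0")
    case True
    then show ?thesis by (simp add: f_def mellin_convergent_def)
  next
    case False
    then show ?thesis
      unfolding f_def using s by (intro mellin_convergent_cmult mellin_convergent_indicator_atLeast) auto
  qed
  \<comment> \<open>Taking absolute values replaces s by Re s, so the L1 condition reduces to
    absolute convergence of the Dirichlet series at s + 1.\<close>
  have f_norm: "norm (mellin (\<lambda>t. of_real (norm (f n t))) (of_real (Re s))) =
      norm (of_int (moebius n) * of_nat n powr (- (s + 1)) :: complex) / Re s" for n
  proof -
    have "(\<lambda>t. complex_of_real (norm (f n t))) =
        (\<lambda>t. of_real (norm (of_int (moebius n) / of_nat n :: complex)) * indicator {real n..} t)"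
      by (auto simp: f_def norm_mult indicator_def)
    then have "norm (mellin (\<lambda>t. of_real (norm (f n t))) (of_real (Re s))) =
        norm (of_int (moebius n) / of_nat n * mellin (indicator {real n..}) (of_real (Re s)))"
      by (simp only: mellin_cmult norm_mult norm_of_real abs_norm_cancel)
    also have "\<dots> = norm (of_int (moebius n) * of_nat n powr (- (of_real (Re s) + 1)) / of_real (Re s) :: complex)"
      using s by (subst mellin_ind) auto
    also have "\<dots> = norm (of_int (moebius n) * of_nat n powr (- (s + 1)) :: complex) / Re s"
      using s by (cases "n = 0") (simp_all add: norm_mult norm_divide norm_powr_real_powr)
    finally show ?thesis .
  qed
  have sm: "summable (\<lambda>n. norm (mellin (\<lambda>t. of_real (norm (f n t))) (of_real (Re s))))"
    unfolding f_norm using s by (intro summable_divide summable_norm_moebius_powr) auto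
  have f_sum: "(\<lambda>t. \<Sum>n. f n t) = (\<lambda>t. of_real (moebius_sum t))"
    by (simp add: f_def moebius_sum_eq_suminf)
  have f_summable: "summable (\<lambda>n. norm (f n t))" for t
    unfolding f_def by (rule summable_norm_moebius_indicator)
  show "mellin_convergent (\<lambda>x. of_real (moebius_sum x)) (Re s)"
    using mellin_convergent_suminf[OF conv f_summable sm] unfolding f_sum .
  have "(\<lambda>n. mellin (f n) s) sums mellin (\<lambda>x. of_real (moebius_sum x)) s"
    using mellin_sums[OF conv f_summable sm] unfolding f_sum .
  moreover have "mellin (f n) s = of_int (moebius n) * of_nat n powr (- (s + 1)) / s" for n
    unfolding f_def mellin_cmult using s by (rule mellin_ind)
  moreover have "(\<lambda>n. of_int (moebius n) * of_nat n powr (- (s + 1)) / s) sums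
     ((\<Sum>n. of_int (moebius n) * of_nat n powr (- (s + 1))) / s)"
    by (intro sums_divide summable_sums summable_norm_cancel[OF summable_norm_moebius_powr]) (use s in auto)
  ultimately have "mellin (\<lambda>x. of_real (moebius_sum x)) s =
      (\<Sum>n. of_int (moebius n) * of_nat n powr (- (s + 1))) / s"
    by (simp add: sums_unique2)
  moreover have "s \<noteq> 0" using s by auto
  ultimately show "mellin (\<lambda>x. of_real (moebius_sum x)) s * (s * zeta (s + 1)) = 1"
    using suminf_moebius_powr_mult_zeta[of "s + 1"] s by simp
qed

section \<open>The functional equation of the zeta function\<close>

text \<open>
  The function \<open>frac_parabola\<close> is \<open>B\<^sub>2({x}) - B\<^sub>2\<close> for the second Bernoulli polynomial; subtracting the constant makes its
  Mellin integral converge absolutely on \<open>0 < Re s < 1\<close>, where it is essentially \<open>\<zeta>(s - 1)\<close>, and its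
  Fourier series integrates termwise to a multiple of \<open>\<zeta>(2 - s)\<close>. The remaining factor, the Mellin
  transform of \<open>cos - 1\<close>, is holomorphic on \<open>0 < Re s < 2\<close>; this suffices to reflect the
  nontrivial zeros, and the Gamma function is not needed.
\<close>

definition frac_parabola :: "real \<Rightarrow> complex" where
  "frac_parabola x = of_real (frac x ^ 2 - frac x)"

lemma borel_measurable_frac_parabola [measurable]: "frac_parabola \<in> borel_measurable borel"
  unfolding frac_parabola_def frac_def by measurable

lemma norm_frac_parabola_le_frac: "norm (frac_parabola x) \<le> frac x"
proof -
  have f: "0 \<le> frac x" "frac x \<le> 1" by (auto simp: less_imp_le[OF frac_lt_1])
  have "norm (frac_parabola x) = frac x - frac x ^ 2"
    using f mult_left_le_one_le[of "frac x" "frac x"]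
    unfolding frac_parabola_def norm_of_real by (simp add: power2_eq_square)
  then show ?thesis using f by simp
qed

lemma norm_frac_parabola_le: "norm (frac_parabola x) \<le> 1"
  using norm_frac_parabola_le_frac[of x] frac_lt_1[of x] by linarith

text \<open>The cut-off function is bounded and vanishes near 0, so its transform exists in a whole
  half-plane. Taken at s + 1, it connects Re s > 1, where \<zeta>(s) is a series, with the strip - 1
  < Re s < 0.\<close>

lemma mellin_convergent_frac_parabola_tail:
  assumes "Re s > 0"
  shows "mellin_convergent (\<lambda>x. frac_parabola x * indicator {1..} x) (Re s)"
proof (rule mellin_convergent_if_bounds[of _ 1 0 1 "Re s + 1" 0])
  show "set_borel_measurable lebesgue {0<..} (\<lambda>x. frac_parabola x * indicator {1..} x)"
    unfolding set_borel_measurable_def by (intro measurable_completion) simp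
qed (use assms norm_frac_parabola_le in \<open>auto simp: norm_mult indicator_def\<close>)

text \<open>\<open>R m\<close> is the primitive of the piece ending at m, evaluated at m. The
  primitive of the piece starting at m exceeds it there by 2 m^(-s) / (s (s + 1)), and these
  excesses build up the zeta series.\<close>

lemma has_integral_frac_parabola_Icc_Suc:
  assumes s: "Re s > 1" and n: "n > 0"
  defines "R \<equiv> \<lambda>m::nat. of_nat m powr (1 - s) / (1 - s) + (2 * of_nat m - 1) * of_nat m powr (- s) / s
               - (of_nat m - 1) * of_nat m powr (- s) / (s + 1)"
  shows "((\<lambda>x. of_real x powr (- s - 2) * frac_parabola x) has_integral
           (R (Suc n) - R n - 2 / (s * (s + 1)) * of_nat n powr (- s))) {real n..real (Suc n)}"
proof -
  have nz: "s \<noteq> 0" "s + 1 \<noteq> 0" "1 - s \<noteq> 0"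
    using s by (auto simp: complex_eq_iff)
  have neg: "x / (- s - 1) = - (x / (s + 1))" for x
    by (metis minus_add_distrib diff_conv_add_uminus minus_divide_right)
  \<comment> \<open>Primitive of the integrand with the parabola written as x^2 - (2 n + 1) x + n (n
    + 1).\<close>
  define Q where "Q = (\<lambda>z. z powr (1 - s) / (1 - s) - (2 * of_nat n + 1) * (z powr (- s) / (- s))
      + of_nat n * (of_nat n + 1) * (z powr (- s - 1) / (- s - 1)) :: complex)"
  have "((\<lambda>x. of_real x powr (- s - 2) * frac_parabola x) has_integral
      (Q (of_real (real (Suc n))) - Q (of_real (real n)))) {real n..real (Suc n)}"
  proof (rule fundamental_theorem_of_calculus)
    fix x assume x: "x \<in> {real n..real (Suc n)}"
    then have x0: "x > 0" using n by (auto intro: less_le_trans)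
    define X where "X = (of_real x :: complex)"
    have X0: "X \<noteq> 0" using x0 by (simp add: X_def)
    \<comment> \<open>At the right endpoint \<open>frac\<close> drops back to 0, but the polynomial
      (x - n)^2 - (x - n) vanishes there too.\<close>
    have P: "frac_parabola x = X\<^sup>2 - (2 * of_nat n + 1) * X + of_nat n * (of_nat n + 1)"
    proof (cases "x = real (Suc n)")
      case True
      then show ?thesis by (simp add: frac_parabola_def X_def power2_eq_square algebra_simps)
    next
      case False
      then have "\<lfloor>x\<rfloor> = int n" using x by (intro floor_unique) auto
      then have "frac x = x - real n" by (simp add: frac_def)
      then have "complex_of_real (frac x) = X - of_nat n" by (simp add: X_def)
      then have "frac_parabola x = (X - of_nat n)\<^sup>2 - (X - of_nat n)" by (simp add: frac_parabola_def)
      then show ?thesis by (simp add: power2_eq_square algebra_simps)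
    qed
    have p1: "X powr (- s) = X * X * X powr (- s - 2)"
      using X0 powr_add[of X 2 "- s - 2"] powr_nat[of X 2] by (simp add: power2_eq_square algebra_simps)
    have p2: "X powr (- s - 1) = X * X powr (- s - 2)"
      using X0 powr_add[of X 1 "- s - 2"] by (simp add: minus_diff_commute[of s 1])
    have exps: "1 - s - 1 = - s" "- s - 1 - 1 = - s - 2" by (auto simp: complex_eq_iff)
    have D: "((\<lambda>z. z powr w / w) has_field_derivative X powr (w - 1)) (at X)" if "w \<noteq> 0" for w
      using x0 that by (auto intro!: derivative_eq_intros simp: complex_nonpos_Reals_iff X_def)
    have "- s - 1 \<noteq> 0" using nz(2) by (metis add.commute add_eq_0_iff diff_eq_eq minus_minus add_0)
    then have "(Q has_field_derivative (X powr (1 - s - 1) - (2 * of_nat n + 1) * X powr (- s - 1)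
       + of_nat n * (of_nat n + 1) * X powr (- s - 1 - 1))) (at X)"
      unfolding Q_def using nz by (intro DERIV_add DERIV_diff DERIV_cmult D) auto
    then have "(Q has_field_derivative (X powr (- s) - (2 * of_nat n + 1) * X powr (- s - 1)
       + of_nat n * (of_nat n + 1) * X powr (- s - 2))) (at X)"
      using exps by (simp only:)
    also have "(X powr (- s) - (2 * of_nat n + 1) * X powr (- s - 1)
       + of_nat n * (of_nat n + 1) * X powr (- s - 2)) = X powr (- s - 2) * frac_parabola x"
      unfolding P p1 p2 by (simp add: algebra_simps power2_eq_square)
    finally have "((\<lambda>x. Q (of_real x)) has_vector_derivative (1 * (X powr (- s - 2) * frac_parabola x))) (at x)"
      unfolding X_def
      by (rule field_vector_diff_chain_at[of of_real 1 x Q, unfolded o_def, rotated])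
         (auto intro: has_vector_derivative_of_real[OF DERIV_ident, of "at x", simplified])
    then show "((\<lambda>x. Q (of_real x)) has_vector_derivative (of_real x powr (- s - 2) * frac_parabola x))
         (at x within {real n..real (Suc n)})"
      by (simp add: has_vector_derivative_at_within X_def)
  qed simp
  also have "Q (of_real (real (Suc n))) = R (Suc n)"
  proof -
    have "of_nat (Suc n) powr (- s) = (of_nat n + 1) * of_nat (Suc n) powr (- s - 1 :: complex)"
      using powr_add[of "of_nat (Suc n) :: complex" 1 "- s - 1"] by simp
    then show ?thesis using neg by (simp add: Q_def R_def mult_ac add_ac)
  qed
  also have "Q (of_real (real n)) = R n + 2 / (s * (s + 1)) * of_nat n powr (- s)"
  proof -
    have lin: "q - (a + (2 * m - 1) * u - (m - 1) * v) = 2 * u - 2 * v"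
      if "q = a - (2 * m + 1) * (- u) + (m + 1) * (- v)" for q a m u v :: complex
      using that by (simp add: algebra_simps)
    have "of_nat n powr (- s) = of_nat n * of_nat n powr (- s - 1 :: complex)"
      using n powr_add[of "of_nat n :: complex" 1 "- s - 1"] by simp
    then have "Q (of_real (real n)) = of_nat n powr (1 - s) / (1 - s)
        - (2 * of_nat n + 1) * (of_nat n powr (- s) / (- s))
        + (of_nat n + 1) * (of_nat n powr (- s) / (- s - 1))"
      by (simp add: Q_def)
    also have "of_nat n powr (- s) / (- s) = - (of_nat n powr (- s) / s)" by simp
    also have "of_nat n powr (- s) / (- s - 1) = - (of_nat n powr (- s) / (s + 1))"
      using neg by simp
    finally have "Q (of_real (real n)) - R n = 2 * (of_nat n powr (- s) / s) - 2 * (of_nat n powr (- s) / (s + 1))"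
      unfolding R_def times_divide_eq_right[symmetric] by (rule lin)
    also have "\<dots> = of_nat n powr (- s) * (2 / s - 2 / (s + 1))" by (simp add: algebra_simps)
    also have "2 / s - 2 / (s + 1) = 2 / (s * (s + 1))" using nz(1,2) by (simp add: field_simps)
    finally show ?thesis by (simp add: algebra_simps)
  qed
  finally show ?thesis by (simp add: algebra_simps)
qed

text \<open>Adding the pieces telescopes \<open>R\<close>. It tends to 0, being of order m^(1 - s),
  so - R 1 and the zeta series remain.\<close>

lemma mellin_frac_parabola_tail:
  assumes s: "Re s > 1"
  shows "mellin (\<lambda>x. frac_parabola x * indicator {1..} x) (s + 1) = - 1 / (1 - s) - 1 / s - 2 / (s * (s + 1)) * zeta s"
proof -
  define h where "h = (\<lambda>x. of_real x powr (- s - 2) * frac_parabola x)"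
  define R where "R = (\<lambda>m::nat. of_nat m powr (1 - s) / (1 - s) + (2 * of_nat m - 1) * of_nat m powr (- s) / s
               - (of_nat m - 1) * of_nat m powr (- s) / (s + 1))"
  have int: "set_integrable lebesgue {1..} h"
  proof -
    have "set_integrable lebesgue {1..} (\<lambda>x. of_real x powr (- (s + 1) - 1) * (frac_parabola x * indicator {1..} x))"
      using mellin_convergent_frac_parabola_tail[of "s + 1"] s unfolding mellin_convergent_iff
      by (rule_tac set_integrable_subset) auto
    also have "?this \<longleftrightarrow> ?thesis"
      by (rule set_integrable_cong) (auto simp: h_def diff_diff_eq)
    finally show ?thesis .
  qed
  have part: "(h has_integral (R (Suc N) - R 1 - 2 / (s * (s + 1)) * (\<Sum>n<N. of_nat (Suc n) powr (- s)))) {1..real (Suc N)}" for N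
  proof (induction N)
    case (Suc N)
    have "(h has_integral (R (Suc N) - R 1 - 2 / (s * (s + 1)) * (\<Sum>n<N. of_nat (Suc n) powr (- s))
       + (R (Suc (Suc N)) - R (Suc N) - 2 / (s * (s + 1)) * of_nat (Suc N) powr (- s)))) {1..real (Suc (Suc N))}"
      by (rule has_integral_combine[OF _ _ Suc.IH])
         (use has_integral_frac_parabola_Icc_Suc[OF s, of "Suc N"] in \<open>auto simp: h_def R_def\<close>)
    then show ?case by (simp add: algebra_simps)
  qed (auto simp: has_integral_refl)
  have "((\<lambda>N. LINT x:{1..real (Suc N)}|lebesgue. h x) \<longlonglongrightarrow> (LINT x:{1..}|lebesgue. h x))"
    by (rule filterlim_compose[OF tendsto_set_lebesgue_integral_at_top[OF _ int]
          filterlim_compose[OF filterlim_real_sequentially filterlim_Suc]]) simp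
  moreover have "(LINT x:{1..real (Suc N)}|lebesgue. h x) =
      R (Suc N) - R 1 - 2 / (s * (s + 1)) * (\<Sum>n<N. of_nat (Suc n) powr (- s))" for N
  proof -
    have "set_integrable lebesgue {1..real (Suc N)} h" using int by (rule set_integrable_subset) auto
    then show ?thesis using part[of N] by (simp add: set_lebesgue_integral_eq_integral(2) integral_unique)
  qed
  moreover have "(\<lambda>N. R (Suc N) - R 1 - 2 / (s * (s + 1)) * (\<Sum>n<N. of_nat (Suc n) powr (- s)))
      \<longlonglongrightarrow> 0 - R 1 - 2 / (s * (s + 1)) * zeta s"
  proof (intro tendsto_diff tendsto_mult tendsto_const)
    show "(\<lambda>N. \<Sum>n<N. of_nat (Suc n) powr (- s)) \<longlonglongrightarrow> zeta s"
      using zeta_sums[OF s] by (simp add: sums_def)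
    have p: "(\<lambda>m::nat. of_nat m powr (1 - s)) \<longlonglongrightarrow> (0::complex)"
    proof (rule Lim_null_comparison)
      show "\<forall>\<^sub>F m in sequentially. norm (of_nat m powr (1 - s) :: complex) \<le> real m powr (1 - Re s)"
        using eventually_gt_at_top[of 0] by eventually_elim (simp add: norm_powr_real_powr)
      show "(\<lambda>m. real m powr (1 - Re s)) \<longlonglongrightarrow> 0"
        using s by real_asymp
    qed
    have q: "(\<lambda>m::nat. of_nat m powr (- s)) \<longlonglongrightarrow> (0::complex)"
    proof (rule Lim_null_comparison)
      show "\<forall>\<^sub>F m in sequentially. norm (of_nat m powr (- s) :: complex) \<le> real m powr (- Re s)"
        using eventually_gt_at_top[of 0] by eventually_elim (simp add: norm_powr_real_powr)
      show "(\<lambda>m. real m powr (- Re s)) \<longlonglongrightarrow> 0"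
        using s by real_asymp
    qed
    have pq: "of_nat m powr (1 - s) = of_nat m * of_nat m powr (- s :: complex)" for m
      by (cases "m = 0") (use powr_add[of "of_nat m :: complex" 1 "- s"] in auto)
    have "R = (\<lambda>m. of_nat m powr (1 - s) * (1 / (1 - s) + 2 / s - 1 / (s + 1)) +
         of_nat m powr (- s) * (1 / (s + 1) - 1 / s))"
      unfolding R_def pq by (auto simp: fun_eq_iff algebra_simps diff_divide_distrib add_divide_distrib)
    moreover have "(\<lambda>m. of_nat m powr (1 - s) * (1 / (1 - s) + 2 / s - 1 / (s + 1)) +
         of_nat m powr (- s) * (1 / (s + 1) - 1 / s)) \<longlonglongrightarrow> 0"
      by (intro tendsto_add_zero tendsto_mult_left_zero p q)
    ultimately have "R \<longlonglongrightarrow> 0" by simp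
    then show "(\<lambda>N. R (Suc N)) \<longlonglongrightarrow> 0" by (rule LIMSEQ_Suc)
  qed
  ultimately have "(LINT x:{1..}|lebesgue. h x) = 0 - R 1 - 2 / (s * (s + 1)) * zeta s"
    using LIMSEQ_unique by simp
  moreover have "mellin (\<lambda>x. frac_parabola x * indicator {1..} x) (s + 1) = (LINT x:{1..}|lebesgue. h x)"
    unfolding mellin_def set_lebesgue_integral_def
    by (intro Bochner_Integration.integral_cong) (auto simp: indicator_def h_def diff_diff_eq)
  ultimately show ?thesis by (simp add: R_def)
qed

text \<open>On (0,1) the parabola is x^2 - x, and its transform is the negative of the rational part
  in \<open>mellin_frac_parabola_tail\<close>; the two cancel when combined. Convergence at 0 forces
  Re s < 0, convergence at infinity Re s > - 1.\<close>

lemma mellin_frac_parabola: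
  assumes s: "- 1 < Re s" "Re s < 0"
  shows "mellin frac_parabola (s + 1) = 1 / (1 - s) + 1 / s + mellin (\<lambda>x. frac_parabola x * indicator {1..} x) (s + 1)"
proof -
  define u where "u = (\<lambda>x::real. of_real x ^ 2 * indicator {0<..1} x - of_real x ^ 1 * indicator {0<..1} x :: complex)"
  have eq: "frac_parabola x = u x + frac_parabola x * indicator {1..} x" if "x > 0" for x
  proof (cases "x < 1")
    case True
    then have "\<lfloor>x\<rfloor> = 0" using that by (intro floor_unique) auto
    then show ?thesis using True that by (auto simp: u_def frac_parabola_def frac_def indicator_def)
  next
    case False
    then show ?thesis by (auto simp: u_def frac_parabola_def indicator_def)
  qed
  have c1: "mellin_convergent (\<lambda>x. of_real x ^ k * indicator {0<..1} x) (Re (s + 1))" if "k \<ge> 1" for k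
    using mellin_convergent_indicator_unit[of "s + 1 - of_nat k"] s that
    by (subst mellin_convergent_power_mult) (auto simp: algebra_simps)
  have u: "mellin_convergent u (Re (s + 1))" "mellin u (s + 1) = 1 / (1 - s) + 1 / s"
  proof -
    show "mellin_convergent u (Re (s + 1))"
      using c1[of 2] c1[of 1] unfolding u_def mellin_convergent_iff
      by (simp add: right_diff_distrib)
    have "mellin u (s + 1) = mellin (indicator {0<..1}) (s - 1) - mellin (indicator {0<..1}) s"
      unfolding u_def using c1[of 2] c1[of 1] mellin_power_mult[of 1 _ "s + 1"]
      by (subst mellin_diff) (simp_all add: mellin_power_mult)
    also have "\<dots> = - 1 / (s - 1) + 1 / s"
      using s by (simp add: mellin_indicator_unit)
    also have "- 1 / (s - 1) = 1 / (1 - s)"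
      by (metis minus_diff_eq minus_divide_divide minus_minus)
    finally show "mellin u (s + 1) = 1 / (1 - s) + 1 / s" .
  qed
  have t: "mellin_convergent (\<lambda>x. frac_parabola x * indicator {1..} x) (Re (s + 1))"
    using s by (intro mellin_convergent_frac_parabola_tail) auto
  have "mellin frac_parabola (s + 1) = mellin (\<lambda>x. u x + frac_parabola x * indicator {1..} x) (s + 1)"
    by (rule mellin_cong[OF eq])
  then show "mellin frac_parabola (s + 1) = 1 / (1 - s) + 1 / s + mellin (\<lambda>x. frac_parabola x * indicator {1..} x) (s + 1)"
    using mellin_add[OF u(1) t] u(2) by simp
qed

text \<open>The tail formula is continued from Re s > 1 to the left, then the part on (0,1) is
  added. Multiplying by s (s + 1) (s - 1) / 2 clears the denominators, so only the point 1, where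
  \<open>zeta\<close> has a dummy value, is cut out of the strip.\<close>

lemma zeta_eq_mellin_frac_parabola:
  assumes s: "- 1 < Re s" "Re s < 0"
  shows "zeta s = - (s * (s + 1) / 2) * mellin frac_parabola (s + 1)"
proof -
  define K where "K = mellin (\<lambda>x. frac_parabola x * indicator {1..} x)"
  define U where "U = {s. - 1 < Re s \<and> Re s < 3} - {1}"
  have hK: "K holomorphic_on {s. 0 < Re s \<and> Re s < 4}"
    unfolding K_def by (rule mellin_holomorphic) (use mellin_convergent_frac_parabola_tail[of "of_real _"] in simp)
  \<comment> \<open>Used with a = s, b = s + 1, c = s - 1: once with y a value of \<zeta>, once with
    y = 0.\<close>
  have clear: "a * b * c / 2 * (1 / c - 1 / a - 2 / (a * b) * y) = a * b / 2 - b * c / 2 - c * y"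
    if "a \<noteq> 0" "b \<noteq> 0" "c \<noteq> 0" for a b c y :: complex
    using that by (simp add: field_simps)
  have "(s - 1) * zeta s = (s + 1) / 2 - s * (s + 1) * (s - 1) / 2 * K (s + 1)"
  proof (rule analytic_continuation_open[of "{s. 1 < Re s \<and> Re s < 3}" U
       "\<lambda>s. (s - 1) * zeta s" "\<lambda>s. (s + 1) / 2 - s * (s + 1) * (s - 1) / 2 * K (s + 1)"])
    show "open {s. 1 < Re s \<and> Re s < 3}" by (rule open_Re_strip)
    show "open U" unfolding U_def by (intro open_delete open_Re_strip)
    have "complex_of_real 2 \<in> {s. 1 < Re s \<and> Re s < 3}" by simp
    then show "{s. 1 < Re s \<and> Re s < 3} \<noteq> {}" by blast
    show "connected U"
      unfolding U_def by (intro connected_open_delete open_Re_strip convex_connected convex_Re_strip) auto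
    show "{s. 1 < Re s \<and> Re s < 3} \<subseteq> U" by (auto simp: U_def)
    show "(\<lambda>s. (s - 1) * zeta s) holomorphic_on U"
      by (intro holomorphic_intros holomorphic_on_subset[OF zeta_holomorphic]) (auto simp: U_def)
    have "(K \<circ> (\<lambda>s. s + 1)) holomorphic_on U"
      by (rule holomorphic_on_compose_gen[OF _ hK]) (auto intro!: holomorphic_intros simp: U_def)
    then show "(\<lambda>s. (s + 1) / 2 - s * (s + 1) * (s - 1) / 2 * K (s + 1)) holomorphic_on U"
      by (auto intro!: holomorphic_intros simp: o_def)
    show "s \<in> U" using s by (auto simp: U_def)
    fix z assume "z \<in> {s. 1 < Re s \<and> Re s < 3}"
    then have z: "Re z > 1" by simp
    then have nz: "z \<noteq> 0" "z + 1 \<noteq> 0" "1 - z \<noteq> 0" "z - 1 \<noteq> 0" by (auto simp: complex_eq_iff)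
    have K: "K (z + 1) = 1 / (z - 1) - 1 / z - 2 / (z * (z + 1)) * zeta z"
      unfolding K_def mellin_frac_parabola_tail[OF z] by (metis minus_diff_eq minus_divide_divide minus_minus)
    show "(z - 1) * zeta z = (z + 1) / 2 - z * (z + 1) * (z - 1) / 2 * K (z + 1)"
      unfolding K clear[OF nz(1,2,4)] by (simp add: field_simps)
  qed
  \<comment> \<open>The vanishing last summand keeps the shape that \<open>clear\<close>
    expects.\<close>
  moreover have "K (s + 1) = mellin frac_parabola (s + 1) + (1 / (s - 1) - 1 / s - 2 / (s * (s + 1)) * 0)"
  proof -
    have "1 / (s - 1) = - (1 / (1 - s))" by (metis minus_diff_eq minus_divide_right)
    then show ?thesis using mellin_frac_parabola[OF s] by (simp add: K_def)
  qed
  moreover have nz: "s \<noteq> 0" "s + 1 \<noteq> 0" "s - 1 \<noteq> 0" using s by (auto simp: complex_eq_iff)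
  ultimately have "(s - 1) * zeta s = (s + 1) / 2 - s * (s + 1) * (s - 1) / 2 *
      (mellin frac_parabola (s + 1) + (1 / (s - 1) - 1 / s - 2 / (s * (s + 1)) * 0))"
    by metis
  also have "\<dots> = (s + 1) / 2 - (s * (s + 1) * (s - 1) / 2 * mellin frac_parabola (s + 1) +
      (s * (s + 1) / 2 - (s + 1) * (s - 1) / 2 - (s - 1) * 0))"
    unfolding distrib_left[of "_ / _"] clear[OF nz] ..
  also have "\<dots> = (s - 1) * (- (s * (s + 1) / 2) * mellin frac_parabola (s + 1))"
    by (simp add: field_simps)
  finally show ?thesis by (rule mult_left_cancel[OF nz(3), THEN iffD1])
qed

section \<open>The Fourier series of the periodic parabola\<close>

lemma inverse_square_power_le:
  "norm z \<le> 1 \<Longrightarrow> norm (z ^ n / of_nat n ^ 2 :: complex) \<le> 1 / real n ^ 2"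
  by (auto simp: norm_divide norm_power divide_right_mono power_le_one)

lemma summable_inverse_squares: "summable (\<lambda>n. 1 / real n ^ 2)"
  using inverse_power_summable[of 2, where ?'a = real] by (simp add: inverse_eq_divide)

lemma summable_dilog:
  assumes "norm z \<le> 1"
  shows "summable (\<lambda>n. z ^ n / of_nat n ^ 2 :: complex)"
  by (rule summable_comparison_test'[OF summable_inverse_squares, of 0])
     (use inverse_square_power_le[OF assms] in auto)

text \<open>The index 0 contributes 1 / 0 = 0. On the unit circle the real part is the cosine series
  with coefficients 1 / n^2.\<close>

definition dilog :: "complex \<Rightarrow> complex" where
  "dilog z = (\<Sum>n. z ^ n / of_nat n ^ 2)"

lemma continuous_on_dilog: "continuous_on (cball 0 1) dilog"
proof -
  have "uniform_limit (cball 0 1) (\<lambda>n z. \<Sum>i<n. z ^ i / of_nat i ^ 2) dilog sequentially"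
    unfolding dilog_def
    by (rule Weierstrass_m_test[OF _ summable_inverse_squares]) (use inverse_square_power_le in auto)
  then show ?thesis
    by (rule uniform_limit_theorem[rotated])
       (auto intro!: always_eventually continuous_intros simp: divide_inverse)
qed

text \<open>Multiplying the derivative by z instead of dividing the logarithm by z keeps the
  statement uniform at the origin.\<close>

lemma has_field_derivative_dilog:
  assumes z: "norm z < 1"
  obtains D where "(dilog has_field_derivative D) (at z)" "z * D = - Ln (1 - z)"
proof
  define c where "c = (\<lambda>n. 1 / of_nat n ^ 2 :: complex)"
  define D where "D = (\<Sum>n. diffs c n * z ^ n)"
  have sm: "summable (\<lambda>n. c n * w ^ n)" if "norm w < 1" for w
    using summable_dilog[of w] that by (simp add: c_def)
  have "((\<lambda>w. \<Sum>n. c n * w ^ n) has_field_derivative D) (at z)"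
    unfolding D_def by (rule termdiffs_strong'[OF sm z])
  then show "(dilog has_field_derivative D) (at z)"
    by (simp add: dilog_def[abs_def] c_def)
  have "summable (\<lambda>n. diffs c n * z ^ n)"
    by (rule termdiff_converges[OF z sm])
  then have "(\<lambda>n. z * (diffs c n * z ^ n)) sums (z * D)"
    unfolding D_def by (intro sums_mult summable_sums)
  moreover have "z * (diffs c n * z ^ n) = z ^ Suc n / of_nat (Suc n)" for n
    by (simp add: diffs_def c_def power2_eq_square del: of_nat_Suc)
  ultimately have "(\<lambda>n. z ^ Suc n / of_nat (Suc n)) sums (z * D)" by simp
  then have "(\<lambda>n. z ^ n / of_nat n) sums (z * D)"
    by (subst (asm) sums_Suc_iff) simp
  moreover have "(\<lambda>n. - (z ^ n / of_nat n)) sums Ln (1 - z)"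
    using Ln_series'[of "- z"] z by simp
  then have "(\<lambda>n. z ^ n / of_nat n) sums (- Ln (1 - z))"
    using sums_minus by fastforce
  ultimately show "z * D = - Ln (1 - z)" by (rule sums_unique2)
qed

text \<open>1 - e^(it) = 2 sin (t / 2) e^(i (t - pi) / 2), and (t - pi) / 2 lies in the principal
  range. This sawtooth is the derivative of the parabola in \<open>Re_dilog_cis\<close>.\<close>

lemma Im_Ln_one_minus_cis:
  assumes t: "0 < t" "t < 2 * pi"
  shows "1 - cis t \<notin> \<real>\<^sub>\<le>\<^sub>0" "Im (Ln (1 - cis t)) = (t - pi) / 2"
proof -
  have sin_pos: "sin (t / 2) > 0" using t by (intro sin_gt_zero) auto
  define w where "w = Complex (ln (2 * sin (t / 2))) ((t - pi) / 2)"
  have "cos t = 1 - 2 * sin (t / 2) ^ 2" "sin t = 2 * sin (t / 2) * cos (t / 2)"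
    using cos_double_sin[of "t / 2"] sin_double[of "t / 2"] by simp_all
  moreover have "cos ((t - pi) / 2) = sin (t / 2)" "sin ((t - pi) / 2) = - cos (t / 2)"
    by (simp_all add: diff_divide_distrib cos_diff sin_diff)
  ultimately have w: "exp w = 1 - cis t"
    using sin_pos by (simp add: complex_eq_iff Re_exp Im_exp w_def power2_eq_square)
  have "Re (1 - cis t) > 0" 
    using \<open>cos t = _\<close> sin_pos by simp
  then show "1 - cis t \<notin> \<real>\<^sub>\<le>\<^sub>0" by (auto simp: complex_nonpos_Reals_iff)
  have "Ln (exp w) = w" using t by (intro Ln_exp) (auto simp: w_def)
  then show "Im (Ln (1 - cis t)) = (t - pi) / 2" unfolding w by (simp add: w_def)
qed

text \<open>At radius r < 1 the angular derivative of Re dilog is Im Ln (1 - r e^(it)). It is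
  bounded by pi, so r can tend to 1 under the integral; on the circle itself the logarithm is
  singular at t = 0.\<close>

lemma Re_dilog_cis:
  assumes \<theta>: "0 \<le> \<theta>" "\<theta> < 2 * pi"
  shows "Re (dilog (cis \<theta>)) - Re (dilog 1) = \<theta> ^ 2 / 4 - pi * \<theta> / 2"
proof -
  define r where "r = (\<lambda>k::nat. real k / real (Suc k))"
  have r: "0 \<le> r k" "r k < 1" for k by (auto simp: r_def)
  have r_lim: "r \<longlonglongrightarrow> 1" unfolding r_def by real_asymp
  define f where "f = (\<lambda>k t. Im (Ln (1 - of_real (r k) * cis t)))"
  \<comment> \<open>The value 0 at t = 0 is the limit there, since Ln (1 - r) is real for 0 \<le> r
    < 1.\<close>
  define g where "g = (\<lambda>t. if t = 0 then 0 else (t - pi) / 2)"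
  have f: "(f k has_integral (Re (dilog (of_real (r k) * cis \<theta>)) - Re (dilog (of_real (r k) * cis 0)))) {0..\<theta>}" for k
  proof (rule fundamental_theorem_of_calculus[OF \<theta>(1)])
    fix t
    define z where "z = of_real (r k) * cis t"
    have "norm z < 1" using r[of k] by (simp add: z_def norm_mult)
    then obtain D where D: "(dilog has_field_derivative D) (at z)" "z * D = - Ln (1 - z)"
      by (rule has_field_derivative_dilog)
    have "((\<lambda>t. of_real (r k) * cis t) has_vector_derivative (\<i> * z)) (at t)"
    proof -
      have "((\<lambda>w. of_real (r k) * exp (\<i> * w)) has_field_derivative \<i> * z) (at (of_real t))"
        unfolding z_def cis_conv_exp by (auto intro!: derivative_eq_intros)
      from field_vector_diff_chain_at[OF has_vector_derivative_of_real[OF DERIV_ident] this]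
      show ?thesis by (simp add: o_def cis_conv_exp)
    qed
    from field_vector_diff_chain_at[OF this, of dilog D] D(1)
    have "((\<lambda>t. dilog (of_real (r k) * cis t)) has_vector_derivative (\<i> * z * D)) (at t)"
      by (simp add: o_def z_def)
    then have "((\<lambda>t. Re (dilog (of_real (r k) * cis t))) has_vector_derivative Re (\<i> * z * D)) (at t)"
      by (rule bounded_linear.has_vector_derivative[OF bounded_linear_Re])
    also have "Re (\<i> * z * D) = f k t"
      using D(2) by (simp add: mult.assoc f_def z_def)
    finally show "((\<lambda>t. Re (dilog (of_real (r k) * cis t))) has_vector_derivative f k t) (at t within {0..\<theta>})"
      by (rule has_vector_derivative_at_within)
  qed
  have "(\<lambda>k. integral {0..\<theta>} (f k)) \<longlonglongrightarrow> integral {0..\<theta>} g"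
  proof (rule dominated_convergence(2)[where h = "\<lambda>_. pi"])
    show "f k integrable_on {0..\<theta>}" for k using f by blast
    show "(\<lambda>_. pi) integrable_on {0..\<theta>}" by (rule integrable_const_ivl)
    show "norm (f k t) \<le> pi" for k t
    proof -
      have "1 - of_real (r k) * cis t \<noteq> 0"
      proof
        assume "1 - of_real (r k) * cis t = 0"
        then have "norm (of_real (r k) * cis t) = 1" by simp
        then show False using r[of k] by (simp add: norm_mult)
      qed
      then show ?thesis
        using mpi_less_Im_Ln Im_Ln_le_pi by (simp add: f_def abs_le_iff less_imp_le minus_le_iff)
    qed
    fix t assume t: "t \<in> {0..\<theta>}"
    show "(\<lambda>k. f k t) \<longlonglongrightarrow> g t"
    proof (cases "t = 0")
      case True
      have "f k 0 = 0" for k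
      proof -
        have "Ln (1 - of_real (r k)) = of_real (ln (1 - r k))"
          using r[of k] Ln_of_real[of "1 - r k"] by simp
        then show ?thesis by (simp add: f_def)
      qed
      with True show ?thesis by (simp add: g_def)
    next
      case False
      then have t': "0 < t" "t < 2 * pi" using t \<theta> by auto
      have "(\<lambda>k. f k t) \<longlonglongrightarrow> Im (Ln (1 - of_real 1 * cis t))"
        unfolding f_def using Im_Ln_one_minus_cis(1)[OF t'] by (intro tendsto_intros r_lim) auto
      then show ?thesis using Im_Ln_one_minus_cis(2)[OF t'] False by (simp add: g_def)
    qed
  qed
  moreover have "(\<lambda>k. integral {0..\<theta>} (f k)) \<longlonglongrightarrow> Re (dilog (of_real 1 * cis \<theta>)) - Re (dilog (of_real 1 * cis 0))"
  proof -
    have "(\<lambda>k. dilog (of_real (r k) * cis t)) \<longlonglongrightarrow> dilog (of_real 1 * cis t)" for t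
    proof (rule continuous_on_tendsto_compose[OF continuous_on_dilog])
      show "(\<lambda>k. of_real (r k) * cis t) \<longlonglongrightarrow> of_real 1 * cis t"
        by (intro tendsto_intros r_lim)
    qed (use r in \<open>auto simp: norm_mult less_imp_le\<close>)
    then show ?thesis
      unfolding integral_unique[OF f] by (intro tendsto_intros)
  qed
  ultimately have "Re (dilog (cis \<theta>)) - Re (dilog 1) = integral {0..\<theta>} g"
    using LIMSEQ_unique by simp
  also have "((\<lambda>t. (t - pi) / 2) has_integral ((\<theta> ^ 2 / 4 - pi * \<theta> / 2) - (0 ^ 2 / 4 - pi * 0 / 2))) {0..\<theta>}"
    by (rule fundamental_theorem_of_calculus[OF \<theta>(1)])
       (auto intro!: derivative_eq_intros simp: diff_divide_distrib simp flip: has_real_derivative_iff_has_vector_derivative)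
  then have "(g has_integral (\<theta> ^ 2 / 4 - pi * \<theta> / 2)) {0..\<theta>}"
    by (rule_tac has_integral_spike_finite[of "{0}", rotated 2]) (auto simp: g_def)
  then have "integral {0..\<theta>} g = \<theta> ^ 2 / 4 - pi * \<theta> / 2" by (rule integral_unique)
  finally show ?thesis .
qed

text \<open>With \<theta> = 2 pi frac x, the quadratic of \<open>Re_dilog_cis\<close> divided by
  pi^2 is the parabola. Subtracting \<open>dilog 1\<close> turns each cosine into cos - 1, which is
  small enough at 0 for a Mellin integral on 0 < Re s < 2.\<close>

lemma frac_parabola_sums:
  "(\<lambda>n. of_real ((cos (2 * pi * real n * x) - 1) / (pi ^ 2 * real n ^ 2))) sums frac_parabola x"
proof -
  define \<theta> where "\<theta> = 2 * pi * frac x"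
  have \<theta>: "0 \<le> \<theta>" "\<theta> < 2 * pi" using frac_lt_1[of x] by (auto simp: \<theta>_def)
  have cos_eq: "cos (2 * pi * real n * x) = cos (real n * \<theta>)" for n
  proof -
    have "2 * pi * real n * x = real n * \<theta> + 2 * pi * of_int (int n * \<lfloor>x\<rfloor>)"
      by (simp add: \<theta>_def frac_def algebra_simps)
    then show ?thesis by (simp only: cos_add cos_int_2pin sin_int_2pin)
  qed
  have "(\<lambda>n. cis \<theta> ^ n / of_nat n ^ 2 - 1 ^ n / of_nat n ^ 2) sums (dilog (cis \<theta>) - dilog 1)"
    unfolding dilog_def by (intro sums_diff summable_sums summable_dilog) auto
  also have "(\<lambda>n. cis \<theta> ^ n / of_nat n ^ 2 - 1 ^ n / of_nat n ^ 2) =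
      (\<lambda>n. (cis (real n * \<theta>) - 1) / of_real (real n ^ 2))"
    by (intro ext) (simp only: Complex.DeMoivre of_real_power of_real_of_nat_eq power_one diff_divide_distrib)
  finally have "(\<lambda>n. (cos (real n * \<theta>) - 1) / real n ^ 2) sums (Re (dilog (cis \<theta>)) - Re (dilog 1))"
    by (drule_tac sums_Re) (simp only: Re_divide_of_real minus_complex.sel cis.sel one_complex.sel)
  then have "(\<lambda>n. (cos (real n * \<theta>) - 1) / real n ^ 2) sums (\<theta> ^ 2 / 4 - pi * \<theta> / 2)"
    unfolding Re_dilog_cis[OF \<theta>] .
  then have "(\<lambda>n. (cos (real n * \<theta>) - 1) / real n ^ 2 / pi ^ 2) sums ((\<theta> ^ 2 / 4 - pi * \<theta> / 2) / pi ^ 2)"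
    by (rule sums_divide)
  moreover have "(\<theta> ^ 2 / 4 - pi * \<theta> / 2) / pi ^ 2 = frac x ^ 2 - frac x"
    by (simp add: \<theta>_def field_simps power2_eq_square)
  ultimately have "(\<lambda>n. (cos (2 * pi * real n * x) - 1) / (pi ^ 2 * real n ^ 2)) sums (frac x ^ 2 - frac x)"
    by (simp only: cos_eq divide_divide_eq_left mult.commute[of "pi ^ 2"])
  then show ?thesis unfolding frac_parabola_def by (rule sums_of_real)
qed

section \<open>The functional equation and the reflection of zeros\<close>

definition cos_minus_one :: "real \<Rightarrow> complex" where
  "cos_minus_one x = of_real (cos x - 1)"

text \<open>The constant bound acts at infinity, the quadratic one at 0; they give the edges 0 and 2
  of the strip of convergence.\<close>

lemma norm_cos_minus_one_le: "norm (cos_minus_one x) \<le> 2" "norm (cos_minus_one x) \<le> x ^ 2"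
proof -
  show "norm (cos_minus_one x) \<le> 2"
    unfolding cos_minus_one_def norm_of_real using cos_ge_minus_one[of x] cos_le_one[of x] by linarith
  have "cos x - 1 = - 2 * sin (x / 2) ^ 2"
    using cos_double_sin[of "x / 2"] by simp
  then have "norm (cos_minus_one x) = 2 * sin (x / 2) ^ 2"
    unfolding cos_minus_one_def norm_of_real by simp
  also have "\<dots> \<le> 2 * (x / 2) ^ 2"
    using abs_sin_x_le_abs_x[of "x / 2", unfolded abs_le_square_iff] by (intro mult_left_mono) simp_all
  also have "\<dots> \<le> x ^ 2" by (simp add: power2_eq_square)
  finally show "norm (cos_minus_one x) \<le> x ^ 2" .
qed

lemma mellin_convergent_cos_minus_one:
  assumes "0 < \<sigma>" "\<sigma> < 2"
  shows "mellin_convergent cos_minus_one \<sigma>"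
proof -
  have "mellin_convergent cos_minus_one (Re (of_real \<sigma>))"
  proof (rule mellin_convergent_if_bounds[of _ 1 1 2 2 0])
    show "set_borel_measurable lebesgue {0<..} cos_minus_one"
      unfolding set_borel_measurable_def cos_minus_one_def by (intro measurable_completion) measurable
  qed (use assms norm_cos_minus_one_le in \<open>auto simp: powr_numeral\<close>)
  then show ?thesis by simp
qed

text \<open>Scaling by 2 pi n and the coefficient 1 / (pi n)^2 make the n-th Fourier term a multiple
  of n^(s - 1), which sums to \<zeta>(1 - s) for Re s < 0. Continuation then reaches the critical
  strip; 0 is removed because 1 - s meets the pole there.\<close>

lemma zeta_functional_equation:
  fixes s :: complex
  assumes s: "- 1 < Re s" "Re s < 1" "s \<noteq> 0"
  shows "zeta s = - (s * (s + 1) / (2 * of_real pi ^ 2)) * of_real (2 * pi) powr (s + 1) * mellin cos_minus_one (s + 1) * zeta (1 - s)"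
proof -
  define c where "c = (\<lambda>n. 1 / (pi ^ 2 * real n ^ 2))"
  define R where "R = (\<lambda>s::complex. - (s * (s + 1) / (2 * of_real pi ^ 2)) * of_real (2 * pi) powr (s + 1) * mellin cos_minus_one (s + 1) * zeta (1 - s))"
  define U where "U = {s. - 1 < Re s \<and> Re s < 1} - {0}"
  have neg: "zeta z = R z" if z: "- 1 < Re z" "Re z < 0" for z
  proof -
    define f where "f = (\<lambda>n x. of_real (c n) * cos_minus_one (2 * pi * real n * x))"
    \<comment> \<open>Stated for any h, as it serves both the cosine term and its absolute
      value.\<close>
    have scale: "of_real (c n) * mellin (\<lambda>x. h (2 * pi * real n * x)) w =
        of_real (2 * pi) powr w / of_real pi ^ 2 * mellin h w * of_nat n powr (w - 2)" for n and w :: complex and h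
    proof (cases "n = 0")
      case False
      have "complex_of_real (2 * pi * real n) powr w = of_real (2 * pi) powr w * (of_nat n powr w :: complex)"
        using powr_times_real[of "of_real (2 * pi)" "of_nat n" w] by simp
      moreover have "of_nat n powr (w - 2) = of_nat n powr w / (of_nat n ^ 2 :: complex)"
        using False by (simp add: powr_diff powr_nat)
      ultimately show ?thesis
        using mellin_scale[of "2 * pi * real n" h w] False by (simp add: c_def)
    qed (simp add: c_def)
    have conv: "mellin_convergent (f n) (Re (z + 1))" for n
    proof (cases "n = 0")
      case True
      then show ?thesis by (simp add: f_def c_def mellin_convergent_def)
    next
      case False
      have "mellin_convergent (\<lambda>x. cos_minus_one (2 * pi * real n * x)) (Re (z + 1))"
        using False z by (subst mellin_convergent_scale) (auto intro: mellin_convergent_cos_minus_one)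
      then show ?thesis unfolding f_def by (rule mellin_convergent_cmult)
    qed
    have f_sums: "(\<lambda>n. f n x) sums frac_parabola x" for x
      using frac_parabola_sums[of x] by (simp add: f_def c_def cos_minus_one_def)
    have f_summable: "summable (\<lambda>n. norm (f n x))" for x
    proof (rule summable_comparison_test'[where N = 0])
      show "summable (\<lambda>n. 2 / pi ^ 2 * (1 / real n ^ 2))"
        by (intro summable_mult summable_inverse_squares)
      show "norm (norm (f n x)) \<le> 2 / pi ^ 2 * (1 / real n ^ 2)" for n
        using mult_left_mono[OF norm_cos_minus_one_le(1)[of "2 * pi * real n * x"], of "c n"]
        by (simp add: f_def c_def norm_mult norm_divide norm_power)
    qed
    \<comment> \<open>The L1 condition is checked at this real point, where Re (2 - w) = 1 - Re z >
      1.\<close>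
    define w where "w = complex_of_real (Re (z + 1))"
    have norm_f: "norm (mellin (\<lambda>x. of_real (norm (f n x))) w) =
       norm (of_real (2 * pi) powr w / of_real pi ^ 2 * mellin (\<lambda>x. of_real (norm (cos_minus_one x))) w) * norm (of_nat n powr (- (2 - w)) :: complex)" for n
    proof -
      have "(\<lambda>x. complex_of_real (norm (f n x))) =
          (\<lambda>x. of_real (c n) * of_real (norm (cos_minus_one (2 * pi * real n * x))))"
        by (auto simp: f_def norm_mult norm_divide norm_power c_def)
      then have "mellin (\<lambda>x. of_real (norm (f n x))) w =
          of_real (c n) * mellin (\<lambda>x. of_real (norm (cos_minus_one (2 * pi * real n * x)))) w"
        by (simp only: mellin_cmult)
      also have "\<dots> = of_real (2 * pi) powr w / of_real pi ^ 2 * mellin (\<lambda>x. of_real (norm (cos_minus_one x))) w *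
          of_nat n powr (w - 2)"
        by (rule scale)
      finally show ?thesis by (simp add: norm_mult norm_divide)
    qed
    have norms: "summable (\<lambda>n. norm (mellin (\<lambda>x. of_real (norm (f n x))) w))"
      unfolding norm_f using z by (intro summable_mult summable_norm_powr) (auto simp: w_def)
    have "(\<lambda>n. mellin (f n) (z + 1)) sums mellin frac_parabola (z + 1)"
      using mellin_sums[OF conv f_summable norms[unfolded w_def]]
      by (simp add: sums_unique[OF f_sums, symmetric])
    moreover have "mellin (f n) (z + 1) =
        of_real (2 * pi) powr (z + 1) / of_real pi ^ 2 * mellin cos_minus_one (z + 1) * of_nat n powr (- (1 - z))" for n
      using scale[of n cos_minus_one "z + 1"] by (simp add: f_def mellin_cmult)
    moreover have "(\<lambda>n. of_real (2 * pi) powr (z + 1) / of_real pi ^ 2 * mellin cos_minus_one (z + 1) * of_nat n powr (- (1 - z))) sums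
        (of_real (2 * pi) powr (z + 1) / of_real pi ^ 2 * mellin cos_minus_one (z + 1) * zeta (1 - z))"
      using z by (intro sums_mult zeta_sums_nat) auto
    ultimately have "mellin frac_parabola (z + 1) = of_real (2 * pi) powr (z + 1) / of_real pi ^ 2 * mellin cos_minus_one (z + 1) * zeta (1 - z)"
      by (simp add: sums_unique2)
    then show ?thesis
      unfolding zeta_eq_mellin_frac_parabola[OF z] R_def by simp
  qed
  have "zeta s = R s"
  proof (rule analytic_continuation_open[of "{s. - 1 < Re s \<and> Re s < 0}" U zeta R])
    show "open {s. - 1 < Re s \<and> Re s < 0}" by (rule open_Re_strip)
    show "open U" unfolding U_def by (intro open_delete open_Re_strip)
    have "complex_of_real (- 1 / 2) \<in> {s. - 1 < Re s \<and> Re s < 0}" by simp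
    then show "{s. - 1 < Re s \<and> Re s < 0} \<noteq> {}" by blast
    show "connected U"
      unfolding U_def by (intro connected_open_delete open_Re_strip convex_connected convex_Re_strip) auto
    show "{s. - 1 < Re s \<and> Re s < 0} \<subseteq> U" by (auto simp: U_def)
    show "zeta holomorphic_on U"
      by (rule holomorphic_on_subset[OF zeta_holomorphic]) (auto simp: U_def)
    have "mellin cos_minus_one holomorphic_on {s. 0 < Re s \<and> Re s < 2}"
      by (rule mellin_holomorphic) (rule mellin_convergent_cos_minus_one)
    then have "(mellin cos_minus_one \<circ> (\<lambda>s. s + 1)) holomorphic_on U"
      by (rule holomorphic_on_compose_gen[rotated]) (auto intro!: holomorphic_intros simp: U_def)
    moreover have "(zeta \<circ> (\<lambda>s. 1 - s)) holomorphic_on U"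
      by (rule holomorphic_on_compose_gen[OF _ zeta_holomorphic]) (auto intro!: holomorphic_intros simp: U_def)
    ultimately show "R holomorphic_on U"
      unfolding R_def o_def by (intro holomorphic_intros) auto
  qed (use s neg in \<open>auto simp: U_def\<close>)
  then show ?thesis by (simp add: R_def)
qed

text \<open>Read at 1 - s, the functional equation has \<open>zeta s\<close> as a factor on the
  right, so a zero at s makes the product vanish whatever the other factors are.\<close>

lemma zeta_zero_reflect:
  assumes "zeta s = 0" "0 < Re s" "Re s < 1"
  shows "zeta (1 - s) = 0"
proof -
  have "1 - s \<noteq> 0" using assms(3) by auto
  then show ?thesis
    using zeta_functional_equation[of "1 - s"] assms by simp
qed

section \<open>The convolution with the Moebius sum\<close>

lemma proper_imp_mellin_convergent:
  assumes "proper \<phi>" "- 1 / 2 < \<sigma>" "\<sigma> \<le> 1"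
  shows "mellin_convergent \<phi> \<sigma>"
proof (rule mellin_convergentI_norm)
  have "\<phi> \<in> borel_measurable (restrict_space lebesgue {0<..})"
    using assms(1) by (simp add: proper_def)
  then show "set_borel_measurable lebesgue {0<..} \<phi>"
    unfolding set_borel_measurable_def by (subst (asm) borel_measurable_restrict_space_iff) auto
  show "mellin_norm \<sigma> \<phi> < \<infinity>" using assms by (simp add: proper_def)
qed

text \<open>By |g(x t)| \<le> x t the integrand is at most x times t |\<psi>(t)|, and the
  substitution of 1 / t identifies the integral of the latter with the Mellin norm of \<phi> at
  \<sigma> = 1.\<close>

lemma norm_moebius_conv_le:
  assumes \<phi>: "mellin_convergent \<phi> 1"
  obtains N where "N \<ge> 0" "\<And>x. x > 0 \<Longrightarrow> norm (moebius_conv \<phi> x) \<le> N * x"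
proof -
  define \<psi> where "\<psi> = (\<lambda>t. \<phi> (inverse t) * of_real (inverse t))"
  \<comment> \<open>Inversion at s = 1 leads to the exponent - 1 - 1, whose weight is t^(2 - 1) =
    t.\<close>
  have "mellin_convergent \<psi> (- 2)"
    using mellin_convergent_inversion[of \<phi> 1] \<phi> by (simp add: \<psi>_def)
  then have "set_integrable lebesgue {0<..} (\<lambda>t. of_real (t powr (- (- 2) - 1)) * \<psi> t)"
    unfolding mellin_convergent_def .
  also have "?this \<longleftrightarrow> set_integrable lebesgue {0<..} (\<lambda>t. of_real t * \<psi> t)"
    by (rule set_integrable_cong) auto
  finally have int: "set_integrable lebesgue {0<..} (\<lambda>t. of_real t * \<psi> t)" .
  define D where "D = (\<lambda>t. norm (indicator {0<..} t *\<^sub>R (of_real t * \<psi> t)))"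
  define N where "N = (LINT t|lebesgue. D t)"
  have D_int: "integrable lebesgue D"
    using int unfolding set_integrable_def D_def by (rule integrable_norm)
  have N0: "N \<ge> 0" unfolding N_def D_def by simp
  have "norm (moebius_conv \<phi> x) \<le> N * x" if x: "x > 0" for x
  proof -
    let ?f = "\<lambda>t. indicator {0<..} t *\<^sub>R (of_real (moebius_sum (x * t)) * \<phi> (inverse t) * of_real (inverse t))"
    have "norm (moebius_conv \<phi> x) \<le> (LINT t|lebesgue. norm (?f t))"
      unfolding moebius_conv_def set_lebesgue_integral_def by (rule integral_norm_bound)
    \<comment> \<open>Only the majorant has to be integrable; a non-integrable left side would have
      integral 0.\<close>
    also have "\<dots> \<le> (LINT t|lebesgue. D t * x)"
    proof (rule integral_mono')
      show "integrable lebesgue (\<lambda>t. D t * x)" using D_int by simp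
      show "0 \<le> D t * x" for t using x by (simp add: D_def)
      show "norm (?f t) \<le> D t * x" for t
      proof (cases "t > 0")
        case True
        have "norm (?f t) = \<bar>moebius_sum (x * t)\<bar> * norm (\<psi> t)"
          using True by (simp add: norm_mult \<psi>_def)
        also have "\<dots> \<le> (x * t) * norm (\<psi> t)"
          using True x by (intro mult_right_mono abs_moebius_sum_le) auto
        also have "\<dots> = D t * x" using True by (simp add: D_def norm_mult)
        finally show ?thesis .
      qed (simp add: D_def)
    qed
    also have "\<dots> = N * x" unfolding N_def by simp
    finally show ?thesis .
  qed
  with N0 show ?thesis by (rule that)
qed

theorem theorem4p1:
  fixes \<phi> :: "real \<Rightarrow> complex" and F :: "complex \<Rightarrow> complex"
  assumes "mellin_proper \<phi>"
    and "\<And>s. - 1 / 2 < Re s \<Longrightarrow> Re s \<le> 1 \<Longrightarrow> F s = mellin \<phi> s"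
    and "continuous_on {s. - 1 / 2 \<le> Re s \<and> Re s \<le> 1} F"
    and "F analytic_on {s. - 1 / 2 < Re s \<and> Re s < 1}"
    and "\<And>s. Re s = - 1 / 2 \<Longrightarrow> F s \<noteq> 0"
    and "moebius_conv \<phi> \<in> O[at_top](\<lambda>x. of_real (x powr (- 1 / 2)))"
  shows "riemann_hypothesis \<and> (\<forall>s. nontrivial_zero s \<longrightarrow> zorder zeta s = 1)"
proof -
  note F = assms(2) and F_cont = assms(3) and F_ana = assms(4) and F_nz = assms(5)
  have conv: "mellin_convergent \<phi> \<sigma>" if "- 1 / 2 < \<sigma>" "\<sigma> \<le> 1" for \<sigma>
    using assms(1) that by (simp add: mellin_proper_def proper_imp_mellin_convergent)
  define G where "G = moebius_conv \<phi>"
  define H where "H = mellin G"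
  have G_def': "G = (\<lambda>x. LINT t:{0<..}|lebesgue. of_real (moebius_sum (x * t)) * \<phi> (inverse t) * of_real (inverse t))"
    by (auto simp: G_def moebius_conv_def fun_eq_iff)
  have gm: "(\<lambda>x. complex_of_real (moebius_sum x)) \<in> borel_measurable borel"
    using borel_measurable_moebius_sum by measurable
  have HF: "mellin_convergent G (Re s)" "H s * (s * zeta (s + 1)) = F s" if s: "0 < Re s" "Re s < 1" for s
  proof -
    have g: "mellin_convergent (\<lambda>x. of_real (moebius_sum x)) (Re s)"
      using s by (intro mellin_convergent_moebius_sum) auto
    have p: "mellin_convergent \<phi> (Re s)" using s by (intro conv) auto
    show "mellin_convergent G (Re s)"
      unfolding G_def' by (rule mellin_convergent_convolution[OF gm g p])
    have "H s = mellin (\<lambda>x. of_real (moebius_sum x)) s * mellin \<phi> s"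
      unfolding H_def G_def' by (rule mellin_convolution[OF gm g p])
    then have "H s * (s * zeta (s + 1)) =
        (mellin (\<lambda>x. of_real (moebius_sum x)) s * (s * zeta (s + 1))) * mellin \<phi> s"
      by (simp add: mult_ac)
    then show "H s * (s * zeta (s + 1)) = F s"
      using s by (simp add: mellin_moebius_sum F)
  qed
  have G_meas: "set_borel_measurable lebesgue {0<..} G"
    using mellin_convergent_measurable[OF HF(1)[of "1 / 2"]] by simp
  obtain N where N: "N \<ge> 0" "\<And>x. x > 0 \<Longrightarrow> norm (G x) \<le> N * x"
    using norm_moebius_conv_le[OF conv[of 1]] unfolding G_def by auto
  obtain C where C: "C > 0" "eventually (\<lambda>x. norm (G x) \<le> C * norm (complex_of_real (x powr (- 1 / 2)))) at_top"
    using landau_o.bigE[OF assms(6)] unfolding G_def by blast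
  then obtain X0 where X0: "\<And>x. x \<ge> X0 \<Longrightarrow> norm (G x) \<le> C * norm (complex_of_real (x powr (- 1 / 2)))"
    unfolding eventually_at_top_linorder by blast
  \<comment> \<open>X \<ge> 1 makes \<open>X powr (- 1 / 2 - Re s)\<close> at most 1 to the right of
    the line Re s = - 1 / 2.\<close>
  define X where "X = max 1 X0"
  have X: "X \<ge> 1" "X > 0" "\<And>x. X \<le> x \<Longrightarrow> norm (G x) \<le> C * x powr (- 1 / 2)"
    using X0 by (auto simp: X_def)
  have small: "norm (G x) \<le> N * x powr 1" if "0 < x" "x < X" for x
    using N(2)[of x] that by simp
  note bounds = G_meas X(2) N(1) less_imp_le[OF C(1)] small X(3)
  have G_conv: "mellin_convergent G \<sigma>" if "- 1 / 2 < \<sigma>" "\<sigma> < 1" for \<sigma>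
    using mellin_convergent_if_bounds[OF bounds, of "of_real \<sigma>"] that by simp
  \<comment> \<open>For Re s < 0 the part of the integral below X stays bounded; only the tail can
    blow up, at the rate C / (Re s + 1 / 2).\<close>
  have H_le: "norm (H s) \<le> N * X powr 2 + C / (Re s + 1 / 2)" if s: "- 1 / 2 < Re s" "Re s < 0" for s
  proof -
    have "norm (H s) \<le> N * (X powr (1 - Re s) / (1 - Re s)) + C * (X powr (- 1 / 2 - Re s) / (Re s - (- 1 / 2)))"
      unfolding H_def by (rule norm_mellin_le_if_bounds[OF bounds]) (use s in auto)
    also have "\<dots> \<le> N * (X powr 2 / 1) + C * (1 / (Re s - (- 1 / 2)))"
    proof (intro add_mono mult_left_mono frac_le)
      show "X powr (1 - Re s) \<le> X powr 2" using X(1) s by (intro powr_mono) auto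
      show "X powr (- 1 / 2 - Re s) \<le> 1"
        using X(1) s powr_mono[of "- 1 / 2 - Re s" 0 X] by simp
    qed (use s N C in auto)
    finally show ?thesis by simp
  qed
  define S where "S = {s. - 1 / 2 < Re s \<and> Re s < 1}"
  \<comment> \<open>With the dummy value \<open>zeta 1 = 0\<close>, the identity at s = 0 would
    assert F 0 = 0; it is continued around this point.\<close>
  define U where "U = S - {0}"
  have key: "H s * (s * zeta (s + 1)) = F s" if s: "s \<in> U" for s
  proof (rule analytic_continuation_open[of "{s. 0 < Re s \<and> Re s < 1}" U "\<lambda>s. H s * (s * zeta (s + 1))" F])
    show "open {s. 0 < Re s \<and> Re s < 1}" by (rule open_Re_strip)
    show "open U" unfolding U_def S_def by (intro open_delete open_Re_strip)
    have "complex_of_real (1 / 2) \<in> {s. 0 < Re s \<and> Re s < 1}" by simp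
    then show "{s. 0 < Re s \<and> Re s < 1} \<noteq> {}" by blast
    show "connected U"
      unfolding U_def S_def
      by (intro connected_open_delete open_Re_strip convex_connected convex_Re_strip) auto
    show "{s. 0 < Re s \<and> Re s < 1} \<subseteq> U" by (auto simp: U_def S_def)
    have "H holomorphic_on S"
      unfolding H_def S_def by (rule mellin_holomorphic) (rule G_conv)
    then have "H holomorphic_on U" by (rule holomorphic_on_subset) (auto simp: U_def)
    moreover have "(zeta \<circ> (\<lambda>s. s + 1)) holomorphic_on U"
      by (rule holomorphic_on_compose_gen[OF _ zeta_holomorphic]) (auto intro!: holomorphic_intros simp: U_def)
    ultimately show "(\<lambda>s. H s * (s * zeta (s + 1))) holomorphic_on U"
      unfolding o_def by (intro holomorphic_intros)
    show "F holomorphic_on U"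
      by (rule holomorphic_on_subset[OF analytic_imp_holomorphic[OF F_ana]]) (auto simp: U_def S_def)
  qed (use s HF in auto)
  have right: "zeta \<rho> \<noteq> 0" if \<rho>: "1 / 2 < Re \<rho>" "Re \<rho> < 1" for \<rho>
  proof
    assume "zeta \<rho> = 0"
    moreover have "\<rho> - 1 \<in> U" using \<rho> by (auto simp: U_def S_def)
    ultimately have "F (\<rho> - 1) = 0" using key[of "\<rho> - 1"] by simp
    then have "mellin \<phi> (\<rho> - 1) = 0" using F[of "\<rho> - 1"] \<rho> by simp
    moreover have "mellin \<phi> (\<rho> - 1) \<noteq> 0"
      using assms(1) \<rho> unfolding mellin_proper_def by auto
    ultimately show False by simp
  qed
  have RH: "Re \<rho> = 1 / 2" if "nontrivial_zero \<rho>" for \<rho>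
  proof (rule ccontr)
    assume "Re \<rho> \<noteq> 1 / 2"
    then consider "Re \<rho> > 1 / 2" | "Re (1 - \<rho>) > 1 / 2" by force
    then show False
      using right[of \<rho>] right[of "1 - \<rho>"] that zeta_zero_reflect[of \<rho>]
      by cases (auto simp: nontrivial_zero_def)
  qed
  have simple: "zorder zeta \<rho> = 1" if zero: "nontrivial_zero \<rho>" for \<rho>
  proof -
    have \<rho>: "zeta \<rho> = 0" "Re \<rho> = 1 / 2" "\<rho> \<noteq> 1"
      using zero RH[OF zero] by (auto simp: nontrivial_zero_def)
    have "deriv zeta \<rho> \<noteq> 0"
    proof
      assume D0: "deriv zeta \<rho> = 0"
      have lim0: "((\<lambda>e. complex_of_real e) \<longlongrightarrow> 0) (at_right 0)"
        by (rule tendsto_eq_intros tendsto_ident_at | simp)+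
      have small_e: "eventually (\<lambda>e. e \<in> {0<..<1 / 2 :: real}) (at_right 0)"
        by (rule eventually_at_right_real) simp
      have "(zeta has_field_derivative 0) (at \<rho>)"
        using holomorphic_derivI[OF zeta_holomorphic _, of \<rho>] \<rho>(3) D0 by (auto simp: open_delete)
      then have "((\<lambda>h. (zeta (\<rho> + h) - zeta \<rho>) / h) \<longlongrightarrow> 0) (at 0)"
        by (simp add: DERIV_def)
      \<comment> \<open>The complex difference quotient is restricted to positive real
        increments.\<close>
      moreover have "filterlim complex_of_real (at 0) (at_right 0)"
        unfolding filterlim_at using lim0 small_e by (auto elim: eventually_mono)
      ultimately have Dlim: "((\<lambda>e. zeta (\<rho> + of_real e) / of_real e) \<longlongrightarrow> 0) (at_right 0)"
        using filterlim_compose \<rho>(1) by fastforce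
      \<comment> \<open>The point \<rho> - 1 lies on the boundary line, so continuity of
        \<open>F\<close> on the closed strip enters here.\<close>
      have F_lim: "((\<lambda>e. F (\<rho> - 1 + of_real e)) \<longlongrightarrow> F (\<rho> - 1)) (at_right 0)"
      proof (rule continuous_on_tendsto_compose[OF F_cont])
        show "((\<lambda>e. \<rho> - 1 + of_real e) \<longlongrightarrow> \<rho> - 1) (at_right 0)"
          using tendsto_add[OF tendsto_const lim0, of "\<rho> - 1"] by simp
        show "\<forall>\<^sub>F e in at_right 0. \<rho> - 1 + of_real e \<in> {s. - 1 / 2 \<le> Re s \<and> Re s \<le> 1}"
          using small_e by eventually_elim (use \<rho> in auto)
      qed (use \<rho> in auto)
      have "((\<lambda>e. F (\<rho> - 1 + of_real e)) \<longlongrightarrow> 0) (at_right 0)"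
      proof (rule Lim_null_comparison)
        show "\<forall>\<^sub>F e in at_right 0. norm (F (\<rho> - 1 + of_real e)) \<le>
            (N * X powr 2 * e + C) * (norm (\<rho> - 1 + of_real e) * norm (zeta (\<rho> + of_real e) / of_real e))"
          using small_e
        proof eventually_elim
          case (elim e)
          define s where "s = \<rho> - 1 + of_real e"
          have e: "e > 0" "e < 1 / 2" using elim by auto
          have s: "Re s = e - 1 / 2" using \<rho> by (simp add: s_def)
          then have "s \<in> U" using e by (auto simp: U_def S_def)
          \<comment> \<open>The factor e is moved from \<zeta> to H: e H(s) is bounded by
            \<open>H_le\<close>, and \<zeta>(\<rho> + e) / e tends to 0.\<close>
          then have "F s = (of_real e * H s) * (s * (zeta (\<rho> + of_real e) / of_real e))"
            using key[of s] e by (simp add: s_def)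
          then have "norm (F s) = (e * norm (H s)) * (norm s * norm (zeta (\<rho> + of_real e) / of_real e))"
            using e by (simp add: norm_mult norm_divide)
          also have "e * norm (H s) \<le> e * (N * X powr 2 + C / e)"
            using H_le[of s] s e by (intro mult_left_mono) auto
          also have "e * (N * X powr 2 + C / e) = N * X powr 2 * e + C"
            using e by (simp add: field_simps)
          finally show ?case by (simp add: s_def mult_right_mono)
        qed
        have "((\<lambda>e. (N * X powr 2 * e + C) * (norm (\<rho> - 1 + of_real e) * norm (zeta (\<rho> + of_real e) / of_real e)))
            \<longlongrightarrow> (N * X powr 2 * 0 + C) * (norm (\<rho> - 1 + 0) * norm (0 :: complex))) (at_right 0)"
          by (intro tendsto_intros lim0 Dlim)
        then show "((\<lambda>e. (N * X powr 2 * e + C) * (norm (\<rho> - 1 + of_real e) * norm (zeta (\<rho> + of_real e) / of_real e)))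
            \<longlongrightarrow> 0) (at_right 0)" by simp
      qed
      with F_lim have "F (\<rho> - 1) = 0"
        by (rule tendsto_unique[rotated]) simp
      then show False using F_nz[of "\<rho> - 1"] \<rho>(2) by simp
    qed
    then show ?thesis
      using \<rho> by (intro zorder_zero_eqI[OF zeta_holomorphic]) auto
  qed
  show ?thesis using RH simple by (auto simp: riemann_hypothesis_def)
qed

end
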